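(* Let $\eta>0$, let $f:\mathbb{R}^d\to\mathbb{R}$ be $\alpha_f$-strongly convex and $g:\mathbb{R}^d\to\mathbb{R}$ be $\alpha_g$-strongly convex ($\alpha_f,\alpha_g>0$), and let $$\pi^{XY}(x,y)\propto\exp\Big(-f(x)-g(y)-\frac{1}{2\eta}\|x-y\|_2^2\Big).$$ Consider the Gibbs sampler: draw $x^0\sim\mu_0^X$; for $k=0,1,2,\dots$, draw $y^k\sim\pi^{Y|X=x^k}\propto\exp(-g(y)-\frac{1}{2\eta}\|x^k-y\|_2^2)$ and then $x^{k+1}\sim\pi^{X|Y=y^k}\propto\exp(-f(x)-\frac{1}{2\eta}\|x-y^k\|_2^2)$. Let $\mu_k^{XY}$ be the law of $(x^k,y^k)$. Then for every $k\ge0$, $$D_{\mathrm{KL}}(\mu_k^{XY}\|\pi^{XY})\le\frac{D_{\mathrm{KL}}(\mu_0^X\|\pi^X)}{(1+\eta\alpha_f)^{2k}(1+\eta\alpha_g)^{2k}}.$$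
   Context: $\pi^X$ denotes the $X$-marginal of $\pi^{XY}$, and $\pi^{Y|X=x}$, $\pi^{X|Y=y}$ its conditionals. $D_{\mathrm{KL}}(\mu\|\nu)=\int\mu\log\frac{\mu}{\nu}$. A function $f$ is $\alpha$-strongly convex if $f(x)-f(y)\ge\nabla f(y)^T(x-y)+\frac{\alpha}{2}\|x-y\|_2^2$ for all $x,y$ (with $\nabla f$ a subgradient). *)

theory Defs
  imports "HOL-Probability.Probability"
begin

definition strongly_convex :: "real \<Rightarrow> ('a::euclidean_space \<Rightarrow> real) \<Rightarrow> bool" where
  "strongly_convex \<alpha> f \<longleftrightarrow>
     (\<forall>y. \<exists>v. \<forall>x. f x - f y \<ge> inner v (x - y) + \<alpha> / 2 * (norm (x - y))\<^sup>2)"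

definition KL_div :: "'a measure \<Rightarrow> 'a measure \<Rightarrow> ereal" where
  "KL_div \<mu> \<nu> =
     (if absolutely_continuous \<nu> \<mu> \<and> sets \<mu> = sets \<nu> \<and>
         integrable \<mu> (\<lambda>x. ln (enn2real (RN_deriv \<nu> \<mu> x)))
      then ereal (\<integral>x. ln (enn2real (RN_deriv \<nu> \<mu> x)) \<partial>\<mu>)
      else \<infinity>)"

definition joint_dens :: "('a::euclidean_space \<Rightarrow> real) \<Rightarrow> ('a \<Rightarrow> real) \<Rightarrow> real \<Rightarrow> 'a \<times> 'a \<Rightarrow> real" where
  "joint_dens f g \<eta> z = exp (- f (fst z) - g (snd z) - (norm (fst z - snd z))\<^sup>2 / (2 * \<eta>))"

definition pi_XY :: "('a::euclidean_space \<Rightarrow> real) \<Rightarrow> ('a \<Rightarrow> real) \<Rightarrow> real \<Rightarrow> ('a \<times> 'a) measure" where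
  "pi_XY f g \<eta> = density lborel
     (\<lambda>z. ennreal (joint_dens f g \<eta> z / (\<integral>w. joint_dens f g \<eta> w \<partial>lborel)))"

definition pi_X :: "('a::euclidean_space \<Rightarrow> real) \<Rightarrow> ('a \<Rightarrow> real) \<Rightarrow> real \<Rightarrow> 'a measure" where
  "pi_X f g \<eta> = distr (pi_XY f g \<eta>) lborel fst"

definition pi_Y_given_X :: "('a::euclidean_space \<Rightarrow> real) \<Rightarrow> real \<Rightarrow> 'a \<Rightarrow> 'a measure" where
  "pi_Y_given_X g \<eta> x = density lborel
     (\<lambda>y. ennreal (exp (- g y - (norm (x - y))\<^sup>2 / (2 * \<eta>)) /
                   (\<integral>y'. exp (- g y' - (norm (x - y'))\<^sup>2 / (2 * \<eta>)) \<partial>lborel)))"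

definition pi_X_given_Y :: "('a::euclidean_space \<Rightarrow> real) \<Rightarrow> real \<Rightarrow> 'a \<Rightarrow> 'a measure" where
  "pi_X_given_Y f \<eta> y = density lborel
     (\<lambda>x. ennreal (exp (- f x - (norm (x - y))\<^sup>2 / (2 * \<eta>)) /
                   (\<integral>x'. exp (- f x' - (norm (x' - y))\<^sup>2 / (2 * \<eta>)) \<partial>lborel)))"

definition gibbs_joint_of :: "('a::euclidean_space \<Rightarrow> real) \<Rightarrow> real \<Rightarrow> 'a measure \<Rightarrow> ('a \<times> 'a) measure" where
  "gibbs_joint_of g \<eta> \<nu> = bind \<nu> (\<lambda>x. distr (pi_Y_given_X g \<eta> x) lborel (\<lambda>y. (x, y)))"

primrec gibbs_X :: "'a measure \<Rightarrow> ('a::euclidean_space \<Rightarrow> real) \<Rightarrow> ('a \<Rightarrow> real) \<Rightarrow> real \<Rightarrow> nat \<Rightarrow> 'a measure" where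
  "gibbs_X \<mu>0 f g \<eta> 0 = \<mu>0"
| "gibbs_X \<mu>0 f g \<eta> (Suc k) =
     bind (gibbs_joint_of g \<eta> (gibbs_X \<mu>0 f g \<eta> k)) (\<lambda>p. pi_X_given_Y f \<eta> (snd p))"

definition gibbs_XY :: "'a measure \<Rightarrow> ('a::euclidean_space \<Rightarrow> real) \<Rightarrow> ('a \<Rightarrow> real) \<Rightarrow> real \<Rightarrow> nat \<Rightarrow> ('a \<times> 'a) measure" where
  "gibbs_XY \<mu>0 f g \<eta> k = gibbs_joint_of g \<eta> (gibbs_X \<mu>0 f g \<eta> k)"

end

theory Submission
  imports Defs
begin

text \<open>
  Both conditionals of \<open>\<pi>\<close> are kernels of the same shape, so one Gibbs round consists of two half steps, and
  it suffices that each of them contracts the divergence by \<open>\<kappa> = (1 + \<eta> \<alpha>\<^sub>f) (1 + \<eta> \<alpha>\<^sub>g)\<close>.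
  By Donsker--Varadhan duality this is the inequality
  \<open>\<integral> exp (\<kappa> P h) d\<pi>\<^sup>X \<le> (\<integral> e\<^sup>h d\<pi>\<^sup>Y)\<^sup>\<kappa>\<close> for bounded \<open>h\<close>, where \<open>P x\<close> is the law of \<open>y\<close> given \<open>x\<close>.
  It is an instance of the Prekopa--Leindler inequality with weight \<open>t = 1 / \<kappa>\<close>.
  Write \<open>N x = \<integral> exp (- g y - |x - y|\<^sup>2 / 2\<eta>) dy\<close>, so that \<open>\<pi>\<^sup>X\<close> has density proportional to \<open>e\<^sup>-\<^sup>f N\<close>.
  At \<open>z = t x + (1 - t) y\<close>, Jensen's inequality under \<open>P x\<close> bounds \<open>ln (N z \<integral> e\<^sup>h dP z)\<close> from below by
  \<open>P h x\<close> plus the tangent of \<open>ln N + |\<cdot>|\<^sup>2 / 2\<eta>\<close> at \<open>x\<close>.  That function has Hessian at most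
  \<open>1 / (\<eta> (1 + \<eta> \<alpha>\<^sub>g))\<close>, because strongly log-concave measures are sub-Gaussian (again by
  Prekopa--Leindler), and the error is absorbed exactly by the strong convexity of \<open>f + |\<cdot>|\<^sup>2 / 2\<eta>\<close>.
  Passing from the \<open>x\<close>-marginal to the joint law costs nothing, by the data processing inequality.
\<close>

section \<open>The Prekopa--Leindler inequality\<close>

text \<open>The set is \<open>b + c A\<close>, written as a preimage so that its measurability is
  immediate. Translates (\<open>c = 1\<close>) serve Brunn--Minkowski, dilates
  (\<open>b = 0\<close>) the level sets after it.\<close>

lemma emeasure_lborel_affine_vimage:
  fixes A :: "real set"
  assumes [measurable]: "A \<in> sets borel" and "0 < c"
  shows "emeasure lborel {x. (x - b) / c \<in> A} = ennreal c * emeasure lborel A"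
proof -
  have [measurable]: "{x. (x - b) / c \<in> A} \<in> sets borel" by measurable
  have "emeasure lborel {x. (x - b) / c \<in> A} = (\<integral>\<^sup>+x. indicator {x. (x - b) / c \<in> A} x \<partial>lborel)"
    by simp
  also have "\<dots> = c * (\<integral>\<^sup>+x. indicator {x. (x - b) / c \<in> A} (b + c * x) \<partial>lborel)"
    using \<open>0 < c\<close> by (subst nn_integral_real_affine[where c=c and t=b]) auto
  also have "(\<integral>\<^sup>+x. indicator {x. (x - b) / c \<in> A} (b + c * x) \<partial>lborel) = (\<integral>\<^sup>+x. indicator A x \<partial>lborel)"
    using \<open>0 < c\<close> by (intro nn_integral_cong) (auto simp: indicator_def)
  finally show ?thesis by simp
qed

text \<open>Translating \<open>A\<close> by an almost minimal point of \<open>B\<close> and \<open>B\<close> by an almost maximal point of \<open>A\<close>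
  gives two subsets of \<open>C\<close> that overlap only in a short interval, so no compactness is needed.\<close>

lemma brunn_minkowski_real_bounded:
  fixes A B C :: "real set"
  assumes [measurable]: "A \<in> sets borel" "B \<in> sets borel" "C \<in> sets borel"
    and ne: "A \<noteq> {}" "B \<noteq> {}" and bdd: "bdd_above A" "bdd_below B"
    and sum: "\<And>a b. a \<in> A \<Longrightarrow> b \<in> B \<Longrightarrow> a + b \<in> C"
  shows "emeasure lborel A + emeasure lborel B \<le> emeasure lborel C"
proof (rule ennreal_le_epsilon)
  fix e :: real assume "0 < e"
  define d where "d = e / 2"
  have d: "d > 0" "2 * d = e" using \<open>0 < e\<close> by (auto simp: d_def)
  obtain a where a: "a \<in> A" "Sup A - d < a"
    using less_cSupD[of A "Sup A - d"] ne d by auto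
  obtain b where b: "b \<in> B" "b < Inf B + d"
    using cInf_lessD[of B "Inf B + d"] ne d by auto
  define A' B' where "A' = {x. x - b \<in> A}" and "B' = {x. x - a \<in> B}"
  have [measurable]: "A' \<in> sets borel" "B' \<in> sets borel"
    unfolding A'_def B'_def by measurable
  have eA: "emeasure lborel A = emeasure lborel A'"
    using emeasure_lborel_affine_vimage[of A 1 b] by (simp add: A'_def)
  have eB: "emeasure lborel B = emeasure lborel B'"
    using emeasure_lborel_affine_vimage[of B 1 a] by (simp add: B'_def)
  let ?J = "{Sup A + Inf B - d .. Sup A + Inf B + d}"
  have "A' \<inter> B' \<subseteq> ?J"
  proof
    fix x assume x: "x \<in> A' \<inter> B'"
    then have "x - b \<le> Sup A" "Inf B \<le> x - a"
      using bdd by (auto simp: A'_def B'_def intro: cSup_upper cInf_lower)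
    with a b show "x \<in> ?J" by auto
  qed
  then have "emeasure lborel (A' \<inter> B') \<le> emeasure lborel ?J"
    by (intro emeasure_mono) auto
  also have "\<dots> = ennreal e" using d by simp
  finally have J: "emeasure lborel (A' \<inter> B') \<le> ennreal e" .
  have "emeasure lborel A' + emeasure lborel B'
      = emeasure lborel (A' \<union> B') + emeasure lborel (A' \<inter> B')"
    by (rule emeasure_Un_Int) auto
  also have "emeasure lborel (A' \<union> B') \<le> emeasure lborel C"
    using sum[OF _ b(1)] sum[OF a(1)]
    by (intro emeasure_mono) (force simp: A'_def B'_def)+
  finally show "emeasure lborel A + emeasure lborel B \<le> emeasure lborel C + ennreal e"
    using J unfolding eA eB by (meson add_mono order_refl order_trans)
qed

text \<open>Exhaustion by one-sidedly bounded pieces. Cutting at \<open>a + n\<close> and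
  \<open>b - n\<close>, relative to points of the two sets, keeps every piece nonempty.\<close>

lemma brunn_minkowski_real:
  fixes A B C :: "real set"
  assumes [measurable]: "A \<in> sets borel" "B \<in> sets borel" "C \<in> sets borel"
    and ne: "A \<noteq> {}" "B \<noteq> {}"
    and sum: "\<And>a b. a \<in> A \<Longrightarrow> b \<in> B \<Longrightarrow> a + b \<in> C"
  shows "emeasure lborel A + emeasure lborel B \<le> emeasure lborel C"
proof -
  obtain a b where ab: "a \<in> A" "b \<in> B" using ne by auto
  let ?A = "\<lambda>n::nat. A \<inter> {..a + n}" and ?B = "\<lambda>n::nat. B \<inter> {b - n..}"
  have Un: "(\<Union>n. ?A n) = A" "(\<Union>n. ?B n) = B"
  proof -
    have "\<exists>n::nat. x \<le> a + n" for x using real_arch_simple[of "x - a"] by (auto simp: algebra_simps)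
    then show "(\<Union>n. ?A n) = A" by auto
    have "\<exists>n::nat. b - n \<le> x" for x using real_arch_simple[of "b - x"] by (auto simp: algebra_simps)
    then show "(\<Union>n. ?B n) = B" by auto
  qed
  have lim: "(\<lambda>n. emeasure lborel (?A n) + emeasure lborel (?B n))
      \<longlonglongrightarrow> emeasure lborel A + emeasure lborel B"
    by (intro tendsto_add)
      (use Lim_emeasure_incseq[of ?A lborel] Lim_emeasure_incseq[of ?B lborel] Un
        in \<open>force simp: incseq_def\<close>)+
  have "emeasure lborel (?A n) + emeasure lborel (?B n) \<le> emeasure lborel C" for n
    using ab by (intro brunn_minkowski_real_bounded) (auto intro: sum)
  then show ?thesis
    by (intro LIMSEQ_le_const2[OF lim]) auto
qed

section \<open>The one-dimensional functional inequality\<close>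

text \<open>Tonelli on the region below the graph. Only levels in \<open>{0<..<1}\<close> are
  integrated, whence the cap at 1; \<open>ennreal\<close> sends negative values of \<open>F\<close>
  to 0, in agreement with the empty range of levels there.\<close>

lemma nn_integral_layer_cake:
  fixes F :: "real \<Rightarrow> real"
  assumes [measurable]: "F \<in> borel_measurable borel"
  shows "(\<integral>\<^sup>+l\<in>{0<..<1}. emeasure lborel {x. l < F x} \<partial>lborel) = (\<integral>\<^sup>+x. ennreal (min 1 (F x)) \<partial>lborel)"
proof -
  have "(\<integral>\<^sup>+l\<in>{0<..<1}. emeasure lborel {x. l < F x} \<partial>lborel)
      = (\<integral>\<^sup>+l. (\<integral>\<^sup>+x. indicator {0<..<1} l * indicator {x. l < F x} x \<partial>lborel) \<partial>lborel)"
    by (auto simp: nn_integral_cmult mult.commute intro!: nn_integral_cong)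
  also have "\<dots> = (\<integral>\<^sup>+x. (\<integral>\<^sup>+l. indicator {0<..<1} l * indicator {x. l < F x} x \<partial>lborel) \<partial>lborel)"
    by (intro lborel_pair.Fubini') measurable
  also have "\<dots> = (\<integral>\<^sup>+x. (\<integral>\<^sup>+l. indicator {0<..<min 1 (F x)} l \<partial>lborel) \<partial>lborel)"
    by (intro nn_integral_cong) (auto simp: indicator_def)
  also have "\<dots> = (\<integral>\<^sup>+x. ennreal (min 1 (F x)) \<partial>lborel)"
  proof (intro nn_integral_cong)
    fix x
    show "(\<integral>\<^sup>+l. indicator {0<..<min 1 (F x)} l \<partial>lborel) = ennreal (min 1 (F x))"
      by (cases "0 \<le> min 1 (F x)") (simp_all add: ennreal_neg del: min_less_iff_conj)
  qed
  finally show ?thesis .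
qed

text \<open>Since \<open>F\<close> and \<open>G\<close> both have supremum 1, their level sets at
  every \<open>l < 1\<close> are nonempty, so Brunn--Minkowski applies to the dilates by
  \<open>t\<close> and \<open>1 - t\<close>, whose sum lies in the level set of \<open>H\<close>.
  Integrating over \<open>l\<close> even yields the arithmetic mean of the two integrals.\<close>

lemma prekopa_leindler_real_normalized:
  fixes F G H :: "real \<Rightarrow> real"
  assumes t: "0 < t" "t < 1"
    and [measurable]: "F \<in> borel_measurable borel" "G \<in> borel_measurable borel" "H \<in> borel_measurable borel"
    and le1: "\<And>x. F x \<le> 1" "\<And>x. G x \<le> 1"
    and sup: "\<And>l. l < 1 \<Longrightarrow> \<exists>x. l < F x" "\<And>l. l < 1 \<Longrightarrow> \<exists>x. l < G x"
    and PL: "\<And>x y. 0 < F x \<Longrightarrow> 0 < G y \<Longrightarrow> F x powr t * G y powr (1 - t) \<le> H (t * x + (1 - t) * y)"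
  shows "ennreal t * (\<integral>\<^sup>+x. F x \<partial>lborel) + ennreal (1 - t) * (\<integral>\<^sup>+x. G x \<partial>lborel) \<le> (\<integral>\<^sup>+x. H x \<partial>lborel)"
proof -
  have F: "(\<integral>\<^sup>+x. F x \<partial>lborel) = (\<integral>\<^sup>+l\<in>{0<..<1}. emeasure lborel {x. l < F x} \<partial>lborel)"
    using le1 by (subst nn_integral_layer_cake) (auto simp: min_absorb2)
  have G: "(\<integral>\<^sup>+x. G x \<partial>lborel) = (\<integral>\<^sup>+l\<in>{0<..<1}. emeasure lborel {x. l < G x} \<partial>lborel)"
    using le1 by (subst nn_integral_layer_cake) (auto simp: min_absorb2)
  have level: "ennreal t * emeasure lborel {x. l < F x} + ennreal (1 - t) * emeasure lborel {x. l < G x}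
      \<le> emeasure lborel {x. l < H x}" if l: "0 < l" "l < 1" for l
  proof -
    have "emeasure lborel {z. z / t \<in> {x. l < F x}} + emeasure lborel {z. z / (1 - t) \<in> {x. l < G x}}
        \<le> emeasure lborel {x. l < H x}"
    proof (rule brunn_minkowski_real)
      obtain x y where "l < F x" "l < G y" using sup l by meson
      then have "t * x \<in> {z. z / t \<in> {x. l < F x}}" "(1 - t) * y \<in> {z. z / (1 - t) \<in> {x. l < G x}}"
        using t by auto
      then show "{z. z / t \<in> {x. l < F x}} \<noteq> {}" "{z. z / (1 - t) \<in> {x. l < G x}} \<noteq> {}" by blast+
    next
      fix a b assume ab: "a \<in> {z. z / t \<in> {x. l < F x}}" "b \<in> {z. z / (1 - t) \<in> {x. l < G x}}"
      have "l = l powr t * l powr (1 - t)" using l by (simp flip: powr_add)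
      also have "\<dots> < F (a / t) powr t * G (b / (1 - t)) powr (1 - t)"
        using ab l t by (intro mult_strict_mono powr_less_mono2) auto
      also have "\<dots> \<le> H (t * (a / t) + (1 - t) * (b / (1 - t)))"
        using ab l by (intro PL) auto
      finally show "a + b \<in> {x. l < H x}" using t by simp
    qed measurable
    then show ?thesis
      using t emeasure_lborel_affine_vimage[of "{x. l < F x}" t 0]
        emeasure_lborel_affine_vimage[of "{x. l < G x}" "1 - t" 0] by simp
  qed
  have "ennreal t * (\<integral>\<^sup>+x. F x \<partial>lborel) + ennreal (1 - t) * (\<integral>\<^sup>+x. G x \<partial>lborel)
    = (\<integral>\<^sup>+l\<in>{0<..<1}. (ennreal t * emeasure lborel {x. l < F x} + ennreal (1 - t) * emeasure lborel {x. l < G x}) \<partial>lborel)"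
    unfolding F G
    by (subst (1 2) nn_integral_cmult[symmetric], measurable, subst nn_integral_add[symmetric], measurable)
       (auto simp: algebra_simps intro!: nn_integral_cong)
  also have "\<dots> \<le> (\<integral>\<^sup>+l\<in>{0<..<1}. emeasure lborel {x. l < H x} \<partial>lborel)"
    using level by (intro nn_integral_mono) (auto simp: indicator_def)
  \<comment> \<open>\<open>H\<close> may exceed 1, so the layer cake only returns the integral of
    \<open>min 1 (H x)\<close>; a lower bound for the integral of \<open>H\<close> is all that is
    wanted.\<close>
  also have "\<dots> \<le> (\<integral>\<^sup>+x. H x \<partial>lborel)"
    by (subst nn_integral_layer_cake) (auto intro!: nn_integral_mono ennreal_leI)
  finally show ?thesis .
qed

text \<open>The hypothesis is homogeneous: dividing \<open>F\<close> and \<open>G\<close> by their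
  suprema \<open>a\<close>, \<open>b\<close> and \<open>H\<close> by
  \<open>a powr t * b powr (1 - t)\<close> gives the normalized case, and weighted AM--GM turns its
  arithmetic mean into the geometric one. If one integral vanishes, so does the left side.\<close>

lemma prekopa_leindler_real:
  fixes F G H :: "real \<Rightarrow> real"
  assumes t: "0 < t" "t < 1"
    and int: "integrable lborel F" "integrable lborel G" "integrable lborel H"
    and nn: "\<And>x. 0 \<le> F x" "\<And>x. 0 \<le> G x" "\<And>x. 0 \<le> H x"
    and bdd: "bdd_above (range F)" "bdd_above (range G)"
    and PL: "\<And>x y. F x powr t * G y powr (1 - t) \<le> H (t * x + (1 - t) * y)"
  shows "(\<integral>x. F x \<partial>lborel) powr t * (\<integral>x. G x \<partial>lborel) powr (1 - t) \<le> (\<integral>x. H x \<partial>lborel)"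
proof (cases "(\<integral>x. F x \<partial>lborel) = 0 \<or> (\<integral>x. G x \<partial>lborel) = 0")
  case True
  then show ?thesis using nn t by (auto simp: Bochner_Integration.integral_nonneg)
next
  case False
  have [measurable]: "F \<in> borel_measurable borel" "G \<in> borel_measurable borel" "H \<in> borel_measurable borel"
    using int by (auto dest: borel_measurable_integrable)
  define a b where "a = Sup (range F)" and "b = Sup (range G)"
  have Fa: "F x \<le> a" and Gb: "G x \<le> b" for x
    using bdd by (auto simp: a_def b_def intro: cSup_upper)
  have a: "a > 0"
  proof (rule ccontr)
    assume "\<not> a > 0"
    then have "F = (\<lambda>x. 0)" using Fa nn(1) by (meson antisym ext not_le order_trans)
    with False show False by simp
  qed
  have b: "b > 0"
  proof (rule ccontr)
    assume "\<not> b > 0"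
    then have "G = (\<lambda>x. 0)" using Gb nn(2) by (meson antisym ext not_le order_trans)
    with False show False by simp
  qed
  define c where "c = a powr t * b powr (1 - t)"
  have c: "c > 0" using a b by (simp add: c_def)
  have supF: "\<exists>x. l < F x / a" if "l < 1" for l
  proof -
    have "l * a < Sup (range F)" using that a by (simp add: a_def[symmetric])
    from less_cSupD[OF _ this] show ?thesis using a by (auto simp: field_simps)
  qed
  have supG: "\<exists>x. l < G x / b" if "l < 1" for l
  proof -
    have "l * b < Sup (range G)" using that b by (simp add: b_def[symmetric])
    from less_cSupD[OF _ this] show ?thesis using b by (auto simp: field_simps)
  qed
  have "ennreal t * (\<integral>\<^sup>+x. F x / a \<partial>lborel) + ennreal (1 - t) * (\<integral>\<^sup>+x. G x / b \<partial>lborel)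
      \<le> (\<integral>\<^sup>+x. H x / c \<partial>lborel)"
  proof (rule prekopa_leindler_real_normalized[OF t])
    fix x y
    have "(F x / a) powr t * (G y / b) powr (1 - t) = F x powr t * G y powr (1 - t) / c"
      using a b nn by (simp add: powr_divide c_def)
    also have "\<dots> \<le> H (t * x + (1 - t) * y) / c"
      using PL c by (intro divide_right_mono) auto
    finally show "(F x / a) powr t * (G y / b) powr (1 - t) \<le> H (t * x + (1 - t) * y) / c" .
  qed (use Fa Gb a b supF supG in auto)
  also have "(\<integral>\<^sup>+x. F x / a \<partial>lborel) = ennreal (\<integral>x. F x / a \<partial>lborel)"
    using int nn a by (intro nn_integral_eq_integral) auto
  also have "(\<integral>\<^sup>+x. G x / b \<partial>lborel) = ennreal (\<integral>x. G x / b \<partial>lborel)"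
    using int nn b by (intro nn_integral_eq_integral) auto
  also have "(\<integral>\<^sup>+x. H x / c \<partial>lborel) = ennreal (\<integral>x. H x / c \<partial>lborel)"
    using int nn c by (intro nn_integral_eq_integral) auto
  finally have "t * (integral\<^sup>L lborel F / a) + (1 - t) * (integral\<^sup>L lborel G / b) \<le> integral\<^sup>L lborel H / c"
    using t nn a b c by (simp flip: ennreal_mult ennreal_plus add: Bochner_Integration.integral_nonneg ennreal_le_iff)
  moreover have "(integral\<^sup>L lborel F / a) powr t * (integral\<^sup>L lborel G / b) powr (1 - t)
      \<le> t * (integral\<^sup>L lborel F / a) + (1 - t) * (integral\<^sup>L lborel G / b)"
    using False nn a b t
    by (intro Youngs_inequality_0) (auto intro!: divide_pos_pos simp: less_le Bochner_Integration.integral_nonneg)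
  moreover have "(integral\<^sup>L lborel F / a) powr t * (integral\<^sup>L lborel G / b) powr (1 - t)
      = (integral\<^sup>L lborel F powr t * integral\<^sup>L lborel G powr (1 - t)) / c"
    using nn a b by (simp add: powr_divide c_def Bochner_Integration.integral_nonneg)
  ultimately have "(integral\<^sup>L lborel F powr t * integral\<^sup>L lborel G powr (1 - t)) / c \<le> integral\<^sup>L lborel H / c"
    by linarith
  then show ?thesis using c by (simp add: divide_le_cancel)
qed

section \<open>Passage to several dimensions\<close>

lemma integrable_indicator_Icc_real: "integrable lborel (indicator {a..b::real} :: real \<Rightarrow> real)"
  by (rule integrable_real_indicator) (auto simp: emeasure_lborel_Icc_eq)

lemma integrable_PiM_box:
  fixes F :: "('i \<Rightarrow> real) \<Rightarrow> real"
  assumes "finite I" and [measurable]: "F \<in> borel_measurable (PiM I (\<lambda>_. lborel))"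
    and F: "\<And>x. x \<in> space (PiM I (\<lambda>_. lborel :: real measure)) \<Longrightarrow>
      0 \<le> F x \<and> F x \<le> M * (\<Prod>i\<in>I. indicator {-R..R} (x i))"
  shows "integrable (PiM I (\<lambda>_. lborel)) F"
proof -
  interpret product_sigma_finite "\<lambda>_. lborel :: real measure" ..
  have "integrable (PiM I (\<lambda>_. lborel)) (\<lambda>x. M * (\<Prod>i\<in>I. indicator {-R..R} (x i)))"
    by (intro integrable_mult_right product_integrable_prod assms(1) integrable_indicator_Icc_real)
  then show ?thesis
    by (rule Bochner_Integration.integrable_bound)
      (use F in \<open>auto intro!: AE_I2 order_trans[OF _ abs_ge_self] simp: abs_of_nonneg\<close>)
qed

text \<open>Induction on the coordinates: the one-dimensional inequality, applied to sections in the
  coordinate \<open>j\<close>, shows that the partial integrals again satisfy the hypothesis. The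
  bound by a multiple of a box indicator provides all integrability needed for Fubini, and it
  survives integration with \<open>M * (2 * R)\<close> in place of \<open>M\<close>; hence
  \<open>M\<close> varies in the induction.\<close>

lemma prekopa_leindler_PiM:
  fixes F G H :: "('i \<Rightarrow> real) \<Rightarrow> real"
  assumes "finite I" and t: "0 < t" "t < 1" and R: "0 \<le> R"
    and "F \<in> borel_measurable (PiM I (\<lambda>_. lborel))"
        "G \<in> borel_measurable (PiM I (\<lambda>_. lborel))"
        "H \<in> borel_measurable (PiM I (\<lambda>_. lborel))"
    and "\<And>x. x \<in> space (PiM I (\<lambda>_. lborel :: real measure)) \<Longrightarrow> 0 \<le> F x \<and> F x \<le> M * (\<Prod>i\<in>I. indicator {-R..R} (x i))"
    and "\<And>x. x \<in> space (PiM I (\<lambda>_. lborel :: real measure)) \<Longrightarrow> 0 \<le> G x \<and> G x \<le> M * (\<Prod>i\<in>I. indicator {-R..R} (x i))"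
    and "\<And>x. x \<in> space (PiM I (\<lambda>_. lborel :: real measure)) \<Longrightarrow> 0 \<le> H x \<and> H x \<le> M * (\<Prod>i\<in>I. indicator {-R..R} (x i))"
    and "\<And>x y. x \<in> space (PiM I (\<lambda>_. lborel :: real measure)) \<Longrightarrow> y \<in> space (PiM I (\<lambda>_. lborel :: real measure)) \<Longrightarrow>
      F x powr t * G y powr (1 - t) \<le> H (\<lambda>i\<in>I. t * x i + (1 - t) * y i)"
  shows "(\<integral>x. F x \<partial>PiM I (\<lambda>_. lborel)) powr t * (\<integral>x. G x \<partial>PiM I (\<lambda>_. lborel)) powr (1 - t)
    \<le> (\<integral>x. H x \<partial>PiM I (\<lambda>_. lborel))"
  using assms(1,5-)
proof (induction I arbitrary: F G H M rule: finite_induct)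
  case empty
  interpret product_sigma_finite "\<lambda>_. lborel :: real measure" ..
  have "integral\<^sup>L (PiM {} (\<lambda>_. lborel)) f = f (\<lambda>_. undefined)" for f :: "('i \<Rightarrow> real) \<Rightarrow> real"
    by (simp add: PiM_empty lebesgue_integral_count_space_finite)
  then show ?case
    using empty(7)[of "\<lambda>_. undefined" "\<lambda>_. undefined"] by (simp add: space_PiM restrict_def)
next
  case (insert j I)
  interpret product_sigma_finite "\<lambda>_. lborel :: real measure" ..
  let ?P = "\<lambda>I. PiM I (\<lambda>_. lborel :: real measure)"
  let ?box = "\<lambda>I x. \<Prod>i\<in>I. indicator {-R..R} (x i) :: real"
  let ?int = "\<lambda>K x. \<integral>s. K (x(j := s)) \<partial>lborel"
  have upd: "x(j := s) \<in> space (?P (insert j I))" if "x \<in> space (?P I)" for x s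
    using that by (auto simp: space_PiM PiE_iff extensional_def)
  have box: "?box (insert j I) (x(j := s)) = indicator {-R..R} s * ?box I x" for x s
    using insert.hyps by (auto intro!: prod.cong)
  have sec: "integrable lborel (\<lambda>s. K (x(j := s)))" "bdd_above (range (\<lambda>s. K (x(j := s))))"
    "0 \<le> ?int K x \<and> ?int K x \<le> (M * (2 * R)) * ?box I x"
    if [measurable]: "K \<in> borel_measurable (?P (insert j I))"
      and K: "\<And>x. x \<in> space (?P (insert j I)) \<Longrightarrow> 0 \<le> K x \<and> K x \<le> M * ?box (insert j I) x"
      and x: "x \<in> space (?P I)"
    for K x
  proof -
    have K': "0 \<le> K (x(j := s))" "K (x(j := s)) \<le> (M * ?box I x) * indicator {-R..R} s" for s
      using K[OF upd[OF x, of s]] unfolding box by (auto simp: mult_ac)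
    have int': "integrable lborel (\<lambda>s. (M * ?box I x) * indicator {-R..R} s)"
      by (intro integrable_mult_right integrable_indicator_Icc_real)
    have "(\<lambda>s. K (x(j := s))) \<in> borel_measurable lborel"
      using x insert.hyps by (intro measurable_compose[OF measurable_component_update]) auto
    then show int: "integrable lborel (\<lambda>s. K (x(j := s)))"
      by (rule Bochner_Integration.integrable_bound[OF int'])
        (auto intro!: AE_I2 simp only: real_norm_def abs_of_nonneg K' order_trans[OF K'(2) abs_ge_self])
    have "K (x(j := s)) \<le> \<bar>M * ?box I x\<bar>" for s
      using K'(2)[of s] by (cases "s \<in> {-R..R}") (simp_all add: order_trans[OF _ abs_ge_self])
    then show "bdd_above (range (\<lambda>s. K (x(j := s))))" by (rule bdd_aboveI2)
    have "?int K x \<le> (\<integral>s. (M * ?box I x) * indicator {-R..R} s \<partial>lborel)"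
      by (intro integral_mono int int' K')
    also have "\<dots> = (M * (2 * R)) * ?box I x" using R by simp
    finally show "0 \<le> ?int K x \<and> ?int K x \<le> (M * (2 * R)) * ?box I x"
      using K' by (auto intro: Bochner_Integration.integral_nonneg)
  qed
  have meas: "?int K \<in> borel_measurable (?P I)" if [measurable]: "K \<in> borel_measurable (?P (insert j I))" for K :: "('i \<Rightarrow> real) \<Rightarrow> real"
  proof -
    have "(\<lambda>p. K ((fst p)(j := snd p))) \<in> borel_measurable (?P I \<Otimes>\<^sub>M lborel)"
      by (intro measurable_compose[OF _ that] measurable_fun_upd[where J=I]) auto
    then show ?thesis
      using lborel.borel_measurable_lebesgue_integral[of "\<lambda>x s. K (x(j := s))" "?P I"]
      by (simp add: case_prod_beta)
  qed
  have "(\<integral>x. ?int F x \<partial>?P I) powr t * (\<integral>x. ?int G x \<partial>?P I) powr (1 - t) \<le> (\<integral>x. ?int H x \<partial>?P I)"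
  proof (rule insert.IH)
    fix x y assume xy: "x \<in> space (?P I)" "y \<in> space (?P I)"
    let ?z = "\<lambda>i\<in>I. t * x i + (1 - t) * y i"
    have z: "?z \<in> space (?P I)" by (auto simp: space_PiM)
    show "?int F x powr t * ?int G y powr (1 - t) \<le> ?int H ?z"
    proof (rule prekopa_leindler_real[OF t])
      fix r s
      have "(\<lambda>i\<in>insert j I. t * (x(j := r)) i + (1 - t) * (y(j := s)) i) = ?z(j := t * r + (1 - t) * s)"
        using insert.hyps by (auto simp: fun_eq_iff)
      then show "F (x(j := r)) powr t * G (y(j := s)) powr (1 - t) \<le> H (?z(j := t * r + (1 - t) * s))"
        using insert.prems(7)[OF upd[OF xy(1), of r] upd[OF xy(2), of s]] by (simp only:)
      show "0 \<le> F (x(j := s))" "0 \<le> G (y(j := s))" "0 \<le> H (?z(j := s))" for s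
        using insert.prems(4)[OF upd[OF xy(1), of s]] insert.prems(5)[OF upd[OF xy(2), of s]]
          insert.prems(6)[OF upd[OF z, of s]] by blast+
    qed (rule sec(1)[OF insert.prems(1,4) xy(1)] sec(1)[OF insert.prems(2,5) xy(2)] sec(1)[OF insert.prems(3,6) z]
        sec(2)[OF insert.prems(1,4) xy(1)] sec(2)[OF insert.prems(2,5) xy(2)]; assumption)+
  next
    fix x assume x: "x \<in> space (?P I)"
    show "0 \<le> ?int F x \<and> ?int F x \<le> (M * (2 * R)) * ?box I x"
      by (rule sec(3)[OF insert.prems(1,4) x])
    show "0 \<le> ?int G x \<and> ?int G x \<le> (M * (2 * R)) * ?box I x"
      by (rule sec(3)[OF insert.prems(2,5) x])
    show "0 \<le> ?int H x \<and> ?int H x \<le> (M * (2 * R)) * ?box I x"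
      by (rule sec(3)[OF insert.prems(3,6) x])
  qed (rule meas insert.prems)+
  moreover have "integral\<^sup>L (?P (insert j I)) K = (\<integral>x. ?int K x \<partial>?P I)"
    if "K \<in> borel_measurable (?P (insert j I))"
      and "\<And>x. x \<in> space (?P (insert j I)) \<Longrightarrow> 0 \<le> K x \<and> K x \<le> M * ?box (insert j I) x" for K
    using that insert.hyps by (intro product_integral_insert integrable_PiM_box) auto
  ultimately show ?case
    using insert.prems by simp
qed

text \<open>\<open>T n K\<close> caps \<open>K\<close> at \<open>n\<close> and restricts it to the
  cube of half-width \<open>n\<close>. Convexity of the cube preserves the hypothesis, so the
  product version applies after identifying \<open>lborel\<close> with the image of a product
  measure, and dominated convergence removes the truncation.\<close>

theorem prekopa_leindler:
  fixes F G H :: "'a::euclidean_space \<Rightarrow> real"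
  assumes t: "0 < t" "t < 1"
    and int: "integrable lborel F" "integrable lborel G" "integrable lborel H"
    and nn: "\<And>x. 0 \<le> F x" "\<And>x. 0 \<le> G x" "\<And>x. 0 \<le> H x"
    and PL: "\<And>x y. F x powr t * G y powr (1 - t) \<le> H (t *\<^sub>R x + (1 - t) *\<^sub>R y)"
  shows "(\<integral>x. F x \<partial>lborel) powr t * (\<integral>x. G x \<partial>lborel) powr (1 - t) \<le> (\<integral>x. H x \<partial>lborel)"
proof -
  have [measurable]: "F \<in> borel_measurable borel" "G \<in> borel_measurable borel" "H \<in> borel_measurable borel"
    using int by (auto dest: borel_measurable_integrable)
  define box :: "nat \<Rightarrow> 'a \<Rightarrow> real" where "box n x = (\<Prod>b\<in>Basis. indicator {-real n..real n} (x \<bullet> b))" for n x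
  have box_eq: "box n x = (if \<forall>b\<in>Basis. \<bar>x \<bullet> b\<bar> \<le> n then 1 else 0)" for n x
    by (auto simp: box_def indicator_def abs_le_iff minus_le_iff intro!: prod.neutral)
  have [measurable]: "box n \<in> borel_measurable borel" for n
    unfolding box_def by measurable
  define T :: "nat \<Rightarrow> ('a \<Rightarrow> real) \<Rightarrow> 'a \<Rightarrow> real" where "T n K x = min (K x) n * box n x" for n K x
  have T_lim: "(\<lambda>n. T n K x) \<longlonglongrightarrow> K x" for K x
  proof (rule tendsto_eventually)
    have "\<forall>\<^sub>F n in sequentially. K x \<le> real n"
      by (rule eventually_mono[OF eventually_ge_at_top[of "nat \<lceil>K x\<rceil>"]]) linarith
    moreover have "\<forall>\<^sub>F n in sequentially. norm x \<le> real n"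
      by (rule eventually_mono[OF eventually_ge_at_top[of "nat \<lceil>norm x\<rceil>"]]) linarith
    ultimately show "\<forall>\<^sub>F n in sequentially. T n K x = K x"
      by eventually_elim (auto simp: T_def box_eq dest: order_trans[OF Basis_le_norm])
  qed
  have int_T: "(\<lambda>n. \<integral>x. T n K x \<partial>lborel) \<longlonglongrightarrow> (\<integral>x. K x \<partial>lborel)"
    if K: "integrable lborel K" and K0: "\<And>x. 0 \<le> K x" for K :: "'a \<Rightarrow> real"
  proof -
    have [measurable]: "K \<in> borel_measurable borel" using K by (auto dest: borel_measurable_integrable)
    show ?thesis
    proof (rule integral_dominated_convergence[where w=K])
      show "T n K \<in> borel_measurable lborel" for n
        unfolding T_def by measurable
      show "AE x in lborel. (\<lambda>n. T n K x) \<longlonglongrightarrow> K x"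
        using T_lim by simp
      show "AE x in lborel. norm (T n K x) \<le> K x" for n
        using K0 by (auto simp: T_def box_eq)
    qed (use K in simp_all)
  qed
  let ?e = "\<lambda>f. (\<Sum>b\<in>Basis. f b *\<^sub>R b) :: 'a"
  let ?P = "PiM (Basis :: 'a set) (\<lambda>_. lborel :: real measure)"
  have e_meas [measurable]: "?e \<in> borel_measurable ?P" by measurable
  have PL_T: "(\<integral>x. T n F x \<partial>lborel) powr t * (\<integral>x. T n G x \<partial>lborel) powr (1 - t) \<le> (\<integral>x. T n H x \<partial>lborel)" for n
  proof -
    have [measurable]: "T n F \<in> borel_measurable borel" "T n G \<in> borel_measurable borel" "T n H \<in> borel_measurable borel"
      unfolding T_def by measurable
    have box_e: "box n (?e x) = (\<Prod>b\<in>Basis. indicator {-real n..real n} (x b))" for x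
      unfolding box_def by (intro prod.cong) (simp_all add: inner_sum_left inner_Basis if_distrib cong: if_cong)
    have T_bound: "0 \<le> T n K (?e x) \<and> T n K (?e x) \<le> real n * (\<Prod>b\<in>Basis. indicator {-real n..real n} (x b))"
      if "\<And>x. 0 \<le> K x" for K x
      unfolding box_e[symmetric] T_def using that by (auto simp: box_eq)
    have "(\<integral>x. T n F (?e x) \<partial>?P) powr t * (\<integral>x. T n G (?e x) \<partial>?P) powr (1 - t) \<le> (\<integral>x. T n H (?e x) \<partial>?P)"
    proof (rule prekopa_leindler_PiM[OF finite_Basis t, where R=n and M=n])
      fix x y :: "'a \<Rightarrow> real"
      define z where "z = t *\<^sub>R ?e x + (1 - t) *\<^sub>R ?e y"
      have z: "?e (\<lambda>i\<in>Basis. t * x i + (1 - t) * y i) = z"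
        by (simp add: z_def scaleR_sum_right sum.distrib[symmetric] algebra_simps)
      show "T n F (?e x) powr t * T n G (?e y) powr (1 - t) \<le> T n H (?e (\<lambda>i\<in>Basis. t * x i + (1 - t) * y i))"
      proof (cases "box n (?e x) = 0 \<or> box n (?e y) = 0")
        case True
        then show ?thesis
          using t nn by (auto simp: T_def box_eq)
      next
        case False
        then have b: "box n (?e x) = 1" "box n (?e y) = 1" by (auto simp: box_eq split: if_splits)
        have "\<bar>z \<bullet> b\<bar> \<le> n" if "b \<in> Basis" for b
        proof -
          have "\<bar>z \<bullet> b\<bar> \<le> t * \<bar>?e x \<bullet> b\<bar> + (1 - t) * \<bar>?e y \<bullet> b\<bar>"
            unfolding z_def inner_add_left inner_scaleR_left
            using t by (intro order_trans[OF abs_triangle_ineq]) (simp add: abs_mult)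
          also have "\<dots> \<le> t * n + (1 - t) * n"
            using b that t by (intro add_mono mult_left_mono) (auto simp: box_eq split: if_splits)
          finally show ?thesis by (simp add: algebra_simps)
        qed
        then have bz: "box n z = 1" by (simp add: box_eq)
        have "min (F (?e x)) n powr t * min (G (?e y)) n powr (1 - t) \<le> F (?e x) powr t * G (?e y) powr (1 - t)"
          using t nn by (intro mult_mono powr_mono2) auto
        also have "\<dots> \<le> H z" unfolding z_def by (rule PL)
        finally have 1: "min (F (?e x)) n powr t * min (G (?e y)) n powr (1 - t) \<le> H z" .
        \<comment> \<open>The cap on \<open>H\<close> is harmless because the truncated left side is
          itself at most \<open>n\<close>. The exponents add up to 1; \<open>n = 0\<close> is
          separate, as \<open>powr\<close> is 0 at base 0.\<close>
        have "min (F (?e x)) n powr t * min (G (?e y)) n powr (1 - t) \<le> real n powr t * real n powr (1 - t)"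
          using t nn by (intro mult_mono powr_mono2) auto
        also have "\<dots> = n" by (cases "n = 0") (auto simp flip: powr_add)
        finally show ?thesis
          using 1 unfolding z by (simp add: T_def b bz)
      qed
    qed (use T_bound nn in \<open>auto intro!: measurable_compose[OF e_meas]\<close>)
    then show ?thesis
      unfolding lborel_eq[where 'a='a] by (subst (1 2 3) integral_distr) auto
  qed
  have T0: "0 \<le> (\<integral>x. T n K x \<partial>lborel)" if "\<And>x. 0 \<le> K x" for n K
    using that by (intro Bochner_Integration.integral_nonneg) (simp add: T_def box_eq)
  show ?thesis
  proof (rule LIMSEQ_le[OF _ int_T[OF int(3) nn(3)]])
    \<comment> \<open>The limiting integrals may be 0; \<open>powr\<close> is still continuous there
      along nonnegative bases because both exponents are positive.\<close>
    show "(\<lambda>n. (\<integral>x. T n F x \<partial>lborel) powr t * (\<integral>x. T n G x \<partial>lborel) powr (1 - t))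
      \<longlonglongrightarrow> (\<integral>x. F x \<partial>lborel) powr t * (\<integral>x. G x \<partial>lborel) powr (1 - t)"
      using t nn T0 by (intro tendsto_mult tendsto_powr' int_T int tendsto_const) auto
  qed (use PL_T in blast)
qed

section \<open>Strong convexity\<close>

lemma strongly_convexE:
  assumes "strongly_convex \<alpha> f"
  obtains v where "\<And>x. f y + v \<bullet> (x - y) + \<alpha> / 2 * (norm (x - y))\<^sup>2 \<le> f x"
proof -
  obtain v where "\<forall>x. f x - f y \<ge> v \<bullet> (x - y) + \<alpha> / 2 * (norm (x - y))\<^sup>2"
    using assms unfolding strongly_convex_def by blast
  then show thesis by (intro that[of v]) (simp add: algebra_simps)
qed

text \<open>The subgradient inequalities at \<open>z\<close>, towards \<open>x\<close> and
  \<open>y\<close>, are averaged with weights \<open>t\<close> and \<open>1 - t\<close>. The linear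
  terms cancel and the squares contribute
  \<open>t * (1 - t)^2 + (1 - t) * t^2 = t * (1 - t)\<close>.\<close>

lemma strongly_convex_combination:
  assumes f: "strongly_convex \<alpha> f" and t: "0 \<le> t" "t \<le> 1"
  shows "f (t *\<^sub>R x + (1 - t) *\<^sub>R y) + \<alpha> / 2 * (t * (1 - t)) * (norm (x - y))\<^sup>2 \<le> t * f x + (1 - t) * f y"
proof -
  define z where "z = t *\<^sub>R x + (1 - t) *\<^sub>R y"
  obtain v where v: "\<And>x. f z + v \<bullet> (x - z) + \<alpha> / 2 * (norm (x - z))\<^sup>2 \<le> f x"
    using strongly_convexE[OF f] by blast
  have xz: "x - z = (1 - t) *\<^sub>R (x - y)" and yz: "y - z = (- t) *\<^sub>R (x - y)"
    by (simp_all add: z_def algebra_simps)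
  have "t * (f z + v \<bullet> (x - z) + \<alpha> / 2 * (norm (x - z))\<^sup>2)
      + (1 - t) * (f z + v \<bullet> (y - z) + \<alpha> / 2 * (norm (y - z))\<^sup>2) \<le> t * f x + (1 - t) * f y"
    using v t by (intro add_mono mult_left_mono) auto
  also have "t * (f z + v \<bullet> (x - z) + \<alpha> / 2 * (norm (x - z))\<^sup>2)
      + (1 - t) * (f z + v \<bullet> (y - z) + \<alpha> / 2 * (norm (y - z))\<^sup>2)
      = f z + \<alpha> / 2 * (t * (1 - t)) * (norm (x - y))\<^sup>2"
    unfolding xz yz norm_scaleR inner_scaleR_right power_mult_distrib power2_abs
    by (simp add: power2_eq_square) (simp add: field_simps)
  finally show ?thesis by (simp add: z_def)
qed

text \<open>A finite convex function on a whole Euclidean space is continuous; this supplies the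
  measurability of the potentials.\<close>

lemma strongly_convex_continuous_on:
  fixes f :: "'a::euclidean_space \<Rightarrow> real"
  assumes f: "strongly_convex \<alpha> f" and "0 \<le> \<alpha>"
  shows "continuous_on UNIV f"
proof (rule convex_on_continuous)
  show "convex_on UNIV f"
  proof (rule convex_onI)
    fix t :: real and x y :: 'a assume t: "0 < t" "t < 1"
    have "0 \<le> \<alpha> / 2 * ((1 - t) * (1 - (1 - t))) * (norm (x - y))\<^sup>2" using t \<open>0 \<le> \<alpha>\<close> by simp
    with strongly_convex_combination[OF f, of "1 - t" x y] t
    show "f ((1 - t) *\<^sub>R x + t *\<^sub>R y) \<le> (1 - t) * f x + t * f y" by simp
  qed simp
qed simp

lemma strongly_convex_borel_measurable:
  "strongly_convex \<alpha> f \<Longrightarrow> 0 \<le> \<alpha> \<Longrightarrow> f \<in> borel_measurable borel"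
  by (intro borel_measurable_continuous_onI strongly_convex_continuous_on)

text \<open>Exponential tilts of a strongly log-concave density therefore keep its constant.\<close>

lemma strongly_convex_add_linear:
  assumes "strongly_convex \<alpha> f"
  shows "strongly_convex \<alpha> (\<lambda>x. f x + u \<bullet> x)"
  unfolding strongly_convex_def
proof
  fix y
  obtain v where v: "\<And>x. f y + v \<bullet> (x - y) + \<alpha> / 2 * (norm (x - y))\<^sup>2 \<le> f x"
    using strongly_convexE[OF assms] by blast
  have "f x + u \<bullet> x - (f y + u \<bullet> y) \<ge> (v + u) \<bullet> (x - y) + \<alpha> / 2 * (norm (x - y))\<^sup>2" for x
    using v[of x] by (simp add: algebra_simps)
  then show "\<exists>v. \<forall>x. f x + u \<bullet> x - (f y + u \<bullet> y) \<ge> v \<bullet> (x - y) + \<alpha> / 2 * (norm (x - y))\<^sup>2" by blast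
qed

text \<open>Expanded around \<open>y\<close>, the square has a linear part, which shifts the
  subgradient, and a quadratic part, which raises the modulus by \<open>1 / \<eta>\<close>. This is
  the modulus of the conditional laws.\<close>

lemma strongly_convex_add_square_dist:
  assumes "strongly_convex \<alpha> f"
  shows "strongly_convex (\<alpha> + 1 / \<eta>) (\<lambda>y. f y + (norm (x - y))\<^sup>2 / (2 * \<eta>))"
  unfolding strongly_convex_def
proof
  fix y
  obtain v where v: "\<And>x. f y + v \<bullet> (x - y) + \<alpha> / 2 * (norm (x - y))\<^sup>2 \<le> f x"
    using strongly_convexE[OF assms] by blast
  have "f z + (norm (x - z))\<^sup>2 / (2 * \<eta>) - (f y + (norm (x - y))\<^sup>2 / (2 * \<eta>))
      \<ge> (v + (1 / \<eta>) *\<^sub>R (y - x)) \<bullet> (z - y) + (\<alpha> + 1 / \<eta>) / 2 * (norm (z - y))\<^sup>2" for z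
  proof -
    have "(norm (x - z))\<^sup>2 = (norm (x - y))\<^sup>2 + 2 * ((y - x) \<bullet> (z - y)) + (norm (z - y))\<^sup>2"
      by (simp add: power2_norm_eq_inner algebra_simps inner_commute)
    then have "(norm (x - z))\<^sup>2 / (2 * \<eta>)
      = (norm (x - y))\<^sup>2 / (2 * \<eta>) + (1 / \<eta>) * ((y - x) \<bullet> (z - y)) + (1 / \<eta>) / 2 * (norm (z - y))\<^sup>2"
      by (simp add: add_divide_distrib)
    then show ?thesis
      using v[of z] by (simp add: inner_add_left distrib_right add_divide_distrib)
  qed
  then show "\<exists>v. \<forall>z. f z + (norm (x - z))\<^sup>2 / (2 * \<eta>) - (f y + (norm (x - y))\<^sup>2 / (2 * \<eta>))
      \<ge> v \<bullet> (z - y) + (\<alpha> + 1 / \<eta>) / 2 * (norm (z - y))\<^sup>2" by blast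
qed

section \<open>Integrability and exponential moments of strongly log-concave densities\<close>

text \<open>The integral factors over the coordinates, and each factor is a multiple of a normal
  density of variance \<open>1 / (2 * a)\<close>.\<close>

lemma integrable_gaussian:
  assumes "0 < a"
  shows "integrable lborel (\<lambda>x::'a::euclidean_space. exp (- a * (norm x)\<^sup>2))"
proof (rule integrableI_nonneg)
  define \<sigma> where "\<sigma> = sqrt (1 / (2 * a))"
  have \<sigma>: "\<sigma> > 0" "\<sigma>\<^sup>2 = 1 / (2 * a)" using assms by (auto simp: \<sigma>_def)
  have "integrable lborel (\<lambda>s. sqrt (2 * pi * \<sigma>\<^sup>2) * normal_density 0 \<sigma> s)"
    using \<sigma> by (intro integrable_mult_right) simp
  then have *: "integrable lborel (\<lambda>s::real. exp (- a * s\<^sup>2))"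
    using \<sigma> assms by (simp add: normal_density_def mult.commute)
  have "(\<integral>\<^sup>+(x::'a). ennreal (exp (- a * (norm x)\<^sup>2)) \<partial>lborel)
      = (\<integral>\<^sup>+(x::'a). (\<Prod>b\<in>Basis. ennreal (exp (- a * (x \<bullet> b)\<^sup>2))) \<partial>lborel)"
    by (intro nn_integral_cong, subst prod_ennreal)
      (simp_all add: exp_sum[symmetric] norm_eq_sqrt_inner euclidean_inner[of x x for x :: 'a]
        sum_nonneg power2_eq_square sum_distrib_left sum_negf)
  also have "\<dots> = (\<Prod>b\<in>(Basis :: 'a set). (\<integral>\<^sup>+s. ennreal (exp (- a * s\<^sup>2)) \<partial>lborel))"
    by (rule nn_integral_lborel_prod) auto
  also have "\<dots> < \<infinity>"
    using * by (simp add: nn_integral_eq_integral power_less_top_ennreal)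
  finally show "(\<integral>\<^sup>+(x::'a). ennreal (exp (- a * (norm x)\<^sup>2)) \<partial>lborel) < \<infinity>" .
qed auto

text \<open>The subgradient bound at 0 has a linear term; half of the quadratic term absorbs it by
  completing the square, and the other half leaves a Gaussian majorant.\<close>

lemma integrable_exp_strongly_convex:
  fixes f :: "'a::euclidean_space \<Rightarrow> real"
  assumes f: "strongly_convex \<alpha> f" and "0 < \<alpha>"
  shows "integrable lborel (\<lambda>x. exp (- f x))"
proof -
  have [measurable]: "f \<in> borel_measurable borel"
    using assms by (auto intro: strongly_convex_borel_measurable)
  obtain v where v: "\<And>x. f 0 + v \<bullet> (x - 0) + \<alpha> / 2 * (norm (x - 0))\<^sup>2 \<le> f x"
    using strongly_convexE[OF f] by blast
  have "integrable lborel (\<lambda>x::'a. exp ((norm v)\<^sup>2 / \<alpha> - f 0) * exp (- (\<alpha> / 4) * (norm x)\<^sup>2))"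
    using \<open>0 < \<alpha>\<close> by (intro integrable_mult_right integrable_gaussian) simp
  then show ?thesis
  proof (rule Bochner_Integration.integrable_bound)
    have "- f x \<le> (norm v)\<^sup>2 / \<alpha> - f 0 - (\<alpha> / 4) * (norm x)\<^sup>2" for x
    proof -
      have "0 \<le> (norm (v + (\<alpha> / 2) *\<^sub>R x))\<^sup>2 / \<alpha>" using \<open>0 < \<alpha>\<close> by simp
      also have "\<dots> = (norm v)\<^sup>2 / \<alpha> + v \<bullet> x + \<alpha> / 4 * (norm x)\<^sup>2"
        using \<open>0 < \<alpha>\<close> unfolding power2_norm_eq_inner
        by (simp add: inner_commute inner_add_left inner_add_right field_simps)
      finally show ?thesis using v[of x] by simp
    qed
    then show "AE x in lborel. norm (exp (- f x)) \<le> norm (exp ((norm v)\<^sup>2 / \<alpha> - f 0) * exp (- (\<alpha> / 4) * (norm x)\<^sup>2))"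
      by (intro AE_I2) (simp add: exp_add[symmetric])
  qed measurable
qed

text \<open>\<open>|s| <= exp (- s) + exp s\<close> dominates the first moment by the two tilts
  along \<open>u\<close> and \<open>- u\<close>.\<close>

lemma integrable_linear_exp_strongly_convex:
  fixes f :: "'a::euclidean_space \<Rightarrow> real"
  assumes f: "strongly_convex \<alpha> f" and "0 < \<alpha>"
  shows "integrable lborel (\<lambda>x. (u \<bullet> x) * exp (- f x))"
proof -
  have [measurable]: "f \<in> borel_measurable borel"
    using assms by (auto intro: strongly_convex_borel_measurable)
  have "integrable lborel (\<lambda>x. exp (- (f x + u \<bullet> x)) + exp (- (f x + (- u) \<bullet> x)))"
    using assms by (intro Bochner_Integration.integrable_add integrable_exp_strongly_convex strongly_convex_add_linear)
  then show ?thesis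
  proof (rule Bochner_Integration.integrable_bound)
    have "\<bar>s\<bar> \<le> exp (- s) + exp s" for s :: real
      using exp_ge_add_one_self[of s] exp_ge_add_one_self[of "- s"] exp_gt_zero[of s] exp_gt_zero[of "-s"] by linarith
    then have "\<bar>u \<bullet> x\<bar> * exp (- f x) \<le> (exp (- (u \<bullet> x)) + exp (u \<bullet> x)) * exp (- f x)" for x
      by (intro mult_right_mono) auto
    then show "AE x in lborel. norm ((u \<bullet> x) * exp (- f x)) \<le> norm (exp (- (f x + u \<bullet> x)) + exp (- (f x + (- u) \<bullet> x)))"
      by (intro AE_I2) (simp add: abs_mult distrib_right exp_add[symmetric] exp_diff[symmetric] algebra_simps)
  qed measurable
qed

lemma integral_exp_pos:
  fixes V :: "'a::euclidean_space \<Rightarrow> real"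
  assumes "integrable lborel (\<lambda>x. exp (V x))"
  shows "0 < (\<integral>x. exp (V x) \<partial>lborel)"
proof -
  have "(\<integral>x. exp (V x) \<partial>lborel) \<noteq> 0"
    using assms by (subst integral_nonneg_eq_0_iff_AE) (auto simp: AE_iff_measurable[OF _ refl])
  moreover have "0 \<le> (\<integral>x. exp (V x) \<partial>lborel)" by (rule Bochner_Integration.integral_nonneg) simp
  ultimately show ?thesis by linarith
qed

text \<open>The tangent line of \<open>exp\<close> at the weighted mean \<open>c\<close> is
  integrated. The weight is left unnormalized so that one statement covers densities against
  Lebesgue measure as well as probability measures (\<open>w = 1\<close>).\<close>

lemma jensen_exp_weighted:
  fixes w \<phi> :: "'a \<Rightarrow> real"
  assumes w: "integrable M w" "\<And>x. 0 \<le> w x" "0 < (\<integral>x. w x \<partial>M)"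
    and \<phi>: "integrable M (\<lambda>x. \<phi> x * w x)" "integrable M (\<lambda>x. exp (\<phi> x) * w x)"
  shows "(\<integral>x. w x \<partial>M) * exp ((\<integral>x. \<phi> x * w x \<partial>M) / (\<integral>x. w x \<partial>M)) \<le> (\<integral>x. exp (\<phi> x) * w x \<partial>M)"
proof -
  define c where "c = (\<integral>x. \<phi> x * w x \<partial>M) / (\<integral>x. w x \<partial>M)"
  have "(\<integral>x. w x \<partial>M) * exp c = (\<integral>x. exp c * (\<phi> x * w x + (1 - c) * w x) \<partial>M)"
    using w \<phi> by (simp add: c_def) (simp add: field_simps)
  also have "\<dots> \<le> (\<integral>x. exp (\<phi> x) * w x \<partial>M)"
  proof (rule integral_mono)
    fix x
    have "exp c * (1 + (\<phi> x - c)) \<le> exp c * exp (\<phi> x - c)"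
      by (intro mult_left_mono exp_ge_add_one_self) simp
    then have "exp c * (1 + (\<phi> x - c)) * w x \<le> exp (\<phi> x) * w x"
      using w(2) by (intro mult_right_mono) (simp_all add: exp_diff)
    then show "exp c * (\<phi> x * w x + (1 - c) * w x) \<le> exp (\<phi> x) * w x"
      by (simp add: algebra_simps)
  qed (use w \<phi> in auto)
  finally show ?thesis by (simp add: c_def)
qed

text \<open>Prekopa--Leindler is applied to the tilts of \<open>e\<^sup>-\<^sup>V\<close> by \<open>u\<close> and by \<open>- t / (1 - t) u\<close>, whose linear parts
  combine to \<open>t u \<bullet> (x - y)\<close>; Jensen bounds the second factor, and \<open>t \<rightarrow> 0\<close> gives the sharp constant.\<close>

lemma log_laplace_strongly_convex_aux:
  fixes V :: "'a::euclidean_space \<Rightarrow> real"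
  assumes V: "strongly_convex \<beta> V" and \<beta>: "0 < \<beta>" and t: "0 < t" "t < 1"
  shows "ln (\<integral>y. exp (u \<bullet> y) * exp (- V y) \<partial>lborel)
    \<le> ln (\<integral>y. exp (- V y) \<partial>lborel)
      + (\<integral>y. (u \<bullet> y) * exp (- V y) \<partial>lborel) / (\<integral>y. exp (- V y) \<partial>lborel) + (norm u)\<^sup>2 / (2 * \<beta> * (1 - t))"
proof -
  let ?s = "t / (1 - t)"
  define Z A B m where "Z = (\<integral>y. exp (- V y) \<partial>lborel)"
    and "A = (\<integral>y. exp (u \<bullet> y) * exp (- V y) \<partial>lborel)"
    and "B = (\<integral>y. exp ((- ?s *\<^sub>R u) \<bullet> y) * exp (- V y) \<partial>lborel)"
    and "m = (\<integral>y. (u \<bullet> y) * exp (- V y) \<partial>lborel) / (\<integral>y. exp (- V y) \<partial>lborel)"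
  have int: "integrable lborel (\<lambda>y. exp (- V y))"
    by (rule integrable_exp_strongly_convex[OF V \<beta>])
  have tilt: "integrable lborel (\<lambda>y. exp (v \<bullet> y) * exp (- V y))" for v
    using integrable_exp_strongly_convex[OF strongly_convex_add_linear[OF V, of "- v"] \<beta>]
    by (simp add: exp_add[symmetric] algebra_simps exp_diff)
  have pos: "Z > 0" "A > 0" "B > 0"
    using integral_exp_pos[OF int] integral_exp_pos[of "\<lambda>y. u \<bullet> y - V y"]
      integral_exp_pos[of "\<lambda>y. (- ?s *\<^sub>R u) \<bullet> y - V y"] tilt[of u] tilt[of "- ?s *\<^sub>R u"]
    by (simp_all add: Z_def A_def B_def exp_diff exp_minus field_simps)
  have "Z * exp ((\<integral>y. ((- ?s *\<^sub>R u) \<bullet> y) * exp (- V y) \<partial>lborel) / Z) \<le> B"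
    unfolding Z_def B_def
    by (rule jensen_exp_weighted[OF int _ _ integrable_linear_exp_strongly_convex[OF V \<beta>] tilt])
      (use pos in \<open>auto simp: Z_def\<close>)
  also have "(\<integral>y. ((- ?s *\<^sub>R u) \<bullet> y) * exp (- V y) \<partial>lborel) / Z = - ?s * m"
    unfolding m_def Z_def[symmetric] inner_scaleR_left mult.assoc integral_mult_right_zero by simp
  finally have B: "Z * exp (- ?s * m) \<le> B" .
  then have lnB: "ln Z - ?s * m \<le> ln B"
    using pos ln_mono[OF B] by (simp add: ln_mult)
  define K where "K = t * (norm u)\<^sup>2 / (2 * \<beta> * (1 - t))"
  have "A powr t * B powr (1 - t) \<le> (\<integral>y. exp K * exp (- V y) \<partial>lborel)"
    unfolding A_def B_def
  proof (rule prekopa_leindler[OF t tilt tilt])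
    fix x y
    \<comment> \<open>Young's inequality with parameter \<open>c\<close>, chosen so that the
      quadratic term, multiplied by \<open>t\<close>, is exactly the gain from strong convexity at
      weight \<open>t\<close>; the rest is the constant \<open>K\<close>.\<close>
    define c where "c = \<beta> * (1 - t)"
    have c: "c > 0" using \<beta> t by (simp add: c_def)
    have "0 \<le> (norm (u - c *\<^sub>R (x - y)))\<^sup>2 / (2 * c)" using c by simp
    also have "(norm (u - c *\<^sub>R (x - y)))\<^sup>2 = (norm u)\<^sup>2 - 2 * c * (u \<bullet> (x - y)) + c\<^sup>2 * (norm (x - y))\<^sup>2"
      using dot_norm_neg[of u "c *\<^sub>R (x - y)"] by (simp add: power_mult_distrib)
    also have "\<dots> / (2 * c) = (norm u)\<^sup>2 / (2 * c) - u \<bullet> (x - y) + c / 2 * (norm (x - y))\<^sup>2"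
      using c by (simp add: diff_divide_distrib add_divide_distrib power2_eq_square)
    finally have "t * (u \<bullet> (x - y)) \<le> t * ((norm u)\<^sup>2 / (2 * c) + c / 2 * (norm (x - y))\<^sup>2)"
      using t by (intro mult_left_mono) auto
    also have "\<dots> = K + \<beta> / 2 * (t * (1 - t)) * (norm (x - y))\<^sup>2"
      by (simp add: K_def c_def algebra_simps)
    finally have "t * (u \<bullet> (x - y)) - t * V x - (1 - t) * V y \<le> K - V (t *\<^sub>R x + (1 - t) *\<^sub>R y)"
      using strongly_convex_combination[OF V, of t x y] t by linarith
    moreover have "t * (u \<bullet> x - V x) + (1 - t) * ((- ?s *\<^sub>R u) \<bullet> y - V y) = t * (u \<bullet> (x - y)) - t * V x - (1 - t) * V y"
      using t by (simp add: inner_diff_right field_simps)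
    ultimately have "exp (t * (u \<bullet> x - V x) + (1 - t) * ((- ?s *\<^sub>R u) \<bullet> y - V y)) \<le> exp (K - V (t *\<^sub>R x + (1 - t) *\<^sub>R y))"
      by simp
    then show "(exp (u \<bullet> x) * exp (- V x)) powr t * (exp ((- ?s *\<^sub>R u) \<bullet> y) * exp (- V y)) powr (1 - t)
        \<le> exp K * exp (- V (t *\<^sub>R x + (1 - t) *\<^sub>R y))"
      by (simp add: powr_def exp_add[symmetric] ln_mult algebra_simps)
  qed (use int in auto)
  then have "A powr t * B powr (1 - t) \<le> exp K * Z" by (simp add: Z_def)
  then have "ln (A powr t * B powr (1 - t)) \<le> ln (exp K * Z)"
    using pos by (intro ln_mono) auto
  then have "t * ln A + (1 - t) * ln B \<le> K + ln Z"
    using pos by (simp add: ln_mult ln_powr)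
  moreover have "(1 - t) * (ln Z - ?s * m) \<le> (1 - t) * ln B"
    using lnB t by (intro mult_left_mono) auto
  moreover have "(1 - t) * (ln Z - ?s * m) = ln Z - t * ln Z - t * m" using t by (simp add: field_simps)
  \<comment> \<open>Once the bound on \<open>ln B\<close> is inserted, a full \<open>ln Z\<close>
    cancels and every remaining term, \<open>K\<close> included, carries a factor
    \<open>t\<close>.\<close>
  ultimately have "t * ln A \<le> t * (ln Z + m + (norm u)\<^sup>2 / (2 * \<beta> * (1 - t)))"
    by (simp add: K_def algebra_simps)
  then have "ln A \<le> ln Z + m + (norm u)\<^sup>2 / (2 * \<beta> * (1 - t))"
    using t by simp
  then show ?thesis by (simp add: A_def Z_def m_def)
qed

text \<open>The limit \<open>t \<rightarrow> 0\<close> of the previous bound: the probability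
  measure proportional to \<open>exp (- V y)\<close> is sub-Gaussian about its mean with variance
  proxy \<open>1 / \<beta>\<close>.\<close>

lemma log_laplace_strongly_convex:
  fixes V :: "'a::euclidean_space \<Rightarrow> real"
  assumes V: "strongly_convex \<beta> V" and \<beta>: "0 < \<beta>"
  shows "ln (\<integral>y. exp (u \<bullet> y) * exp (- V y) \<partial>lborel)
    \<le> ln (\<integral>y. exp (- V y) \<partial>lborel)
      + (\<integral>y. (u \<bullet> y) * exp (- V y) \<partial>lborel) / (\<integral>y. exp (- V y) \<partial>lborel) + (norm u)\<^sup>2 / (2 * \<beta>)"
    (is "_ \<le> ?a + ?b + _")
proof (rule tendsto_lowerbound)
  show "((\<lambda>t. ?a + ?b + (norm u)\<^sup>2 / (2 * \<beta> * (1 - t))) \<longlongrightarrow> ?a + ?b + (norm u)\<^sup>2 / (2 * \<beta>)) (at_right 0)"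
    using \<beta> by (auto intro!: tendsto_eq_intros)
  show "\<forall>\<^sub>F t in at_right 0. ln (\<integral>y. exp (u \<bullet> y) * exp (- V y) \<partial>lborel) \<le> ?a + ?b + (norm u)\<^sup>2 / (2 * \<beta> * (1 - t))"
    by (auto simp: eventually_at_right_field intro!: exI[of _ 1] log_laplace_strongly_convex_aux[OF V \<beta>])
qed simp

section \<open>Kullback--Leibler contraction by duality\<close>

text \<open>Clamping a density to the range from \<open>1 / Suc n\<close> to \<open>Suc n\<close>
  makes its logarithm a bounded test function, as the duality formula requires.\<close>

lemma abs_ln_clamp_le:
  "\<bar>ln (max (1 / real (Suc n)) (min (real (Suc n)) x))\<bar> \<le> ln (real (Suc n))"
proof -
  have n: "0 < 1 / real (Suc n)" "1 / real (Suc n) \<le> real (Suc n)" by (simp_all add: field_simps)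
  let ?y = "max (1 / real (Suc n)) (min (real (Suc n)) x)"
  have "1 / real (Suc n) \<le> ?y" "?y \<le> real (Suc n)" using n by auto
  then have "ln (1 / real (Suc n)) \<le> ln ?y" "ln ?y \<le> ln (real (Suc n))"
    using n by (auto intro!: ln_mono simp: less_max_iff_disj simp del: of_nat_Suc)
  then show ?thesis by (simp add: ln_div)
qed

locale abs_cont_prob =
  fixes \<pi> \<nu> :: "'a measure"
  assumes prob_\<pi>: "prob_space \<pi>" and prob_\<nu>: "prob_space \<nu>"
    and ac: "absolutely_continuous \<pi> \<nu>" and sets_eq: "sets \<nu> = sets \<pi>"
begin

sublocale \<pi>: prob_space \<pi> by (rule prob_\<pi>)
sublocale \<nu>: prob_space \<nu> by (rule prob_\<nu>)

definition dens :: "'a \<Rightarrow> real" where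
  "dens x = enn2real (RN_deriv \<pi> \<nu> x)"

lemma space_eq: "space \<nu> = space \<pi>"
  by (rule sets_eq_imp_space_eq[OF sets_eq])

lemma measurable_\<nu>: "f \<in> \<nu> \<rightarrow>\<^sub>M M \<longleftrightarrow> f \<in> \<pi> \<rightarrow>\<^sub>M M"
  using measurable_cong_sets[OF sets_eq refl] by blast

lemma dens_measurable [measurable]: "dens \<in> borel_measurable \<pi>"
  unfolding dens_def by measurable

lemma dens_nonneg: "0 \<le> dens x"
  by (simp add: dens_def)

lemma RN_deriv_eq_dens: "AE x in \<pi>. RN_deriv \<pi> \<nu> x = ennreal (dens x)"
  using \<pi>.RN_deriv_finite[OF \<nu>.sigma_finite_measure_axioms ac sets_eq]
  by eventually_elim (simp add: dens_def top.not_eq_extremum)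

lemma density_dens: "density \<pi> (\<lambda>x. ennreal (dens x)) = \<nu>"
  using \<pi>.density_RN_deriv[OF ac sets_eq] density_cong[OF _ _ RN_deriv_eq_dens] by simp

text \<open>A measure gives no mass to the zero set of its own density, so the values of
  \<open>ln\<close> and of division at 0 never matter for \<nu>-integrals.\<close>

lemma dens_pos: "AE x in \<nu>. 0 < dens x"
proof -
  have "AE x in density \<pi> (\<lambda>x. ennreal (dens x)). 0 < dens x"
    by (subst AE_density) auto
  then show ?thesis unfolding density_dens .
qed

lemma nn_integral_dens: "(\<integral>\<^sup>+x. ennreal (dens x) \<partial>\<pi>) = 1"
  using \<nu>.emeasure_space_1 emeasure_density[of "\<lambda>x. ennreal (dens x)" \<pi> "space \<pi>"]
  by (simp add: density_dens space_eq)

lemma dens_integrable: "integrable \<pi> dens" and dens_integral: "(\<integral>x. dens x \<partial>\<pi>) = 1"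
proof -
  show "integrable \<pi> dens"
    by (rule integrableI_nonneg) (auto simp: dens_nonneg nn_integral_dens)
  then show "(\<integral>x. dens x \<partial>\<pi>) = 1"
    using nn_integral_eq_integral[of \<pi> dens] nn_integral_dens by (simp add: dens_nonneg)
qed

text \<open>The factor \<open>dens\<close> cancels against the quotient where it is positive. Where
  it vanishes the quotient is 0 by convention, so mass of \<pi> may be lost and only an inequality
  remains.\<close>

lemma divide_dens:
  fixes \<psi> :: "'a \<Rightarrow> real"
  assumes \<psi>: "integrable \<pi> \<psi>" "\<And>x. 0 \<le> \<psi> x"
  shows "integrable \<nu> (\<lambda>x. \<psi> x / dens x)" "(\<integral>x. \<psi> x / dens x \<partial>\<nu>) \<le> (\<integral>x. \<psi> x \<partial>\<pi>)"
proof -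
  have [measurable]: "\<psi> \<in> borel_measurable \<pi>" using \<psi> by auto
  have [measurable]: "(\<lambda>x. \<psi> x / dens x) \<in> borel_measurable \<nu>"
    unfolding measurable_\<nu> by measurable
  have "(\<integral>\<^sup>+x. ennreal (\<psi> x / dens x) \<partial>\<nu>) = (\<integral>\<^sup>+x. ennreal (dens x) * ennreal (\<psi> x / dens x) \<partial>\<pi>)"
    using nn_integral_density[of "\<lambda>x. ennreal (dens x)" \<pi> "\<lambda>x. ennreal (\<psi> x / dens x)"]
    by (simp add: density_dens)
  also have "\<dots> \<le> (\<integral>\<^sup>+x. ennreal (\<psi> x) \<partial>\<pi>)"
    using \<psi>(2) dens_nonneg
    by (intro nn_integral_mono) (auto simp: ennreal_mult[symmetric] intro!: ennreal_leI)
  also have "\<dots> = ennreal (\<integral>x. \<psi> x \<partial>\<pi>)"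
    using \<psi> by (intro nn_integral_eq_integral) auto
  finally have le: "(\<integral>\<^sup>+x. ennreal (\<psi> x / dens x) \<partial>\<nu>) \<le> ennreal (\<integral>x. \<psi> x \<partial>\<pi>)" .
  show int: "integrable \<nu> (\<lambda>x. \<psi> x / dens x)"
    using \<psi>(2) dens_nonneg le by (intro integrableI_nonneg) (auto intro: le_less_trans)
  show "(\<integral>x. \<psi> x / dens x \<partial>\<nu>) \<le> (\<integral>x. \<psi> x \<partial>\<pi>)"
    using le \<psi>(2) dens_nonneg by (subst (asm) nn_integral_eq_integral[OF int]) auto
qed

text \<open>With \<open>c\<close> the integral of \<open>exp (\<phi> x)\<close> under \<pi>, the
  bound \<open>1 + s <= exp s\<close> is integrated under \<nu> at
  \<open>s = \<phi> x - ln (dens x) - ln c\<close>; the right side integrates to at most 1 by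
  \<open>divide_dens\<close>.\<close>

lemma donsker_varadhan:
  fixes \<phi> :: "'a \<Rightarrow> real"
  assumes int: "integrable \<nu> (\<lambda>x. ln (dens x))"
    and [measurable]: "\<phi> \<in> borel_measurable \<pi>" and \<phi>: "\<And>x. x \<in> space \<pi> \<Longrightarrow> \<bar>\<phi> x\<bar> \<le> C"
  shows "(\<integral>x. \<phi> x \<partial>\<nu>) \<le> (\<integral>x. ln (dens x) \<partial>\<nu>) + ln (\<integral>x. exp (\<phi> x) \<partial>\<pi>)"
proof -
  define c where "c = (\<integral>x. exp (\<phi> x) \<partial>\<pi>)"
  have e: "integrable \<pi> (\<lambda>x. exp (\<phi> x))"
    using \<phi> by (intro \<pi>.integrable_const_bound[where B="exp C"]) (auto simp: abs_le_iff)
  have "exp (- C) \<le> c" unfolding c_def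
    using \<phi> by (intro \<pi>.integral_ge_const e) (auto simp: abs_le_iff minus_le_iff)
  then have c: "c > 0" using exp_gt_zero[of "- C"] by linarith
  have \<phi>\<nu>: "integrable \<nu> \<phi>"
    using \<phi> by (intro \<nu>.integrable_const_bound[where B=C]) (auto simp: space_eq measurable_\<nu>)
  have "1 + (\<integral>x. \<phi> x \<partial>\<nu>) - (\<integral>x. ln (dens x) \<partial>\<nu>) - ln c
      = (\<integral>x. 1 + \<phi> x - ln (dens x) - ln c \<partial>\<nu>)"
    using int \<phi>\<nu> by (simp add: \<nu>.prob_space)
  also have "\<dots> \<le> (\<integral>x. exp (\<phi> x) / dens x / c \<partial>\<nu>)"
  proof (rule integral_mono_AE)
    show "AE x in \<nu>. 1 + \<phi> x - ln (dens x) - ln c \<le> exp (\<phi> x) / dens x / c"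
      using dens_pos
    proof eventually_elim
      case (elim x)
      have "1 + (\<phi> x - ln (dens x) - ln c) \<le> exp (\<phi> x - ln (dens x) - ln c)"
        by (rule exp_ge_add_one_self)
      also have "\<dots> = exp (\<phi> x) / dens x / c" using elim c by (simp add: exp_diff)
      finally show ?case by simp
    qed
    show "integrable \<nu> (\<lambda>x. exp (\<phi> x) / dens x / c)"
      using divide_dens(1)[OF e] by (intro integrable_divide) simp
  qed (use int \<phi>\<nu> in auto)
  also have "\<dots> = (\<integral>x. exp (\<phi> x) / dens x \<partial>\<nu>) / c" by (rule integral_divide_zero)
  also have "\<dots> \<le> 1"
    using divide_dens(2)[OF e] c by (simp add: c_def)
  finally show ?thesis by (simp add: c_def)
qed

lemma KL_div_eq: "KL_div \<nu> \<pi> = (if integrable \<nu> (\<lambda>x. ln (dens x)) then ereal (\<integral>x. ln (dens x) \<partial>\<nu>) else \<infinity>)"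
  using ac sets_eq by (simp add: KL_div_def dens_def)

text \<open>The clamped logarithms \<open>h n\<close> converge to \<open>ln (dens x)\<close>, and
  Fatou's lemma gives integrability and the bound together. Fatou needs nonnegative integrands, so
  the \<nu>-integrable function \<open>1 / dens x\<close> is added first and its integral
  \<open>c\<close> is subtracted at the end.\<close>

lemma KL_div_le:
  assumes D: "0 \<le> D"
    and le: "\<And>n. (\<integral>x. ln (max (1 / real (Suc n)) (min (real (Suc n)) (dens x))) \<partial>\<nu>) \<le> D + 1 / real (Suc n)"
  shows "KL_div \<nu> \<pi> \<le> ereal D"
proof -
  define h where "h n x = ln (max (1 / real (Suc n)) (min (real (Suc n)) (dens x)))" for n x
  define c where "c = (\<integral>x. 1 / dens x \<partial>\<nu>)"
  have [measurable]: "dens \<in> borel_measurable \<nu>" by (simp add: measurable_\<nu>)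
  have h_meas [measurable]: "h n \<in> borel_measurable \<nu>" for n unfolding h_def by measurable
  have inv: "integrable \<nu> (\<lambda>x. 1 / dens x)" using divide_dens(1)[of "\<lambda>_. 1"] by simp
  have c0: "0 \<le> c" unfolding c_def by (intro Bochner_Integration.integral_nonneg) (simp add: dens_nonneg)
  have h_int: "integrable \<nu> (h n)" for n
    by (intro \<nu>.integrable_const_bound[where B="ln (real (Suc n))"]) (simp_all add: h_def abs_ln_clamp_le del: of_nat_Suc)
  \<comment> \<open>Uniform in \<open>n\<close>: clamping never takes a value below
    \<open>min 1 (dens x)\<close>, and \<open>ln s >= - 1 / s\<close>.\<close>
  have h_ge: "0 \<le> h n x + 1 / dens x" if "0 < dens x" for n x
  proof -
    have "- 1 / dens x \<le> ln (dens x)"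
      using ln_le_minus_one[of "1 / dens x"] that by (simp add: ln_div)
    then have "ln (min 1 (dens x)) + 1 / dens x \<ge> 0"
      using that by (cases "dens x \<le> 1") (auto simp: min_def)
    moreover have "ln (min 1 (dens x)) \<le> h n x"
    proof -
      have "min 1 (dens x) \<le> min (real (Suc n)) (dens x)" by auto
      then show ?thesis unfolding h_def using that by (intro ln_mono) (auto simp: le_max_iff_disj)
    qed
    ultimately show ?thesis by linarith
  qed
  have lim: "(\<lambda>n. h n x) \<longlonglongrightarrow> ln (dens x)" if "0 < dens x" for x
  proof (rule tendsto_eventually)
    have "\<forall>\<^sub>F n in sequentially. dens x \<le> real n"
      by (rule eventually_mono[OF eventually_ge_at_top[of "nat \<lceil>dens x\<rceil>"]]) linarith
    moreover have "\<forall>\<^sub>F n in sequentially. 1 / dens x \<le> real n"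
      by (rule eventually_mono[OF eventually_ge_at_top[of "nat \<lceil>1 / dens x\<rceil>"]]) linarith
    ultimately show "\<forall>\<^sub>F n in sequentially. h n x = ln (dens x)"
    proof eventually_elim
      case (elim n)
      then have "1 / real (Suc n) \<le> dens x" using that by (simp add: field_simps)
      then show ?case using elim by (simp add: h_def max_def min_def)
    qed
  qed
  have "(\<integral>\<^sup>+x. ennreal (ln (dens x) + 1 / dens x) \<partial>\<nu>)
      = (\<integral>\<^sup>+x. liminf (\<lambda>n. ennreal (h n x + 1 / dens x)) \<partial>\<nu>)"
  proof (rule nn_integral_cong_AE)
    show "AE x in \<nu>. ennreal (ln (dens x) + 1 / dens x) = liminf (\<lambda>n. ennreal (h n x + 1 / dens x))"
      using dens_pos
    proof eventually_elim
      case (elim x)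
      have "(\<lambda>n. ennreal (h n x + 1 / dens x)) \<longlonglongrightarrow> ennreal (ln (dens x) + 1 / dens x)"
        by (intro tendsto_ennrealI tendsto_add lim elim tendsto_const)
      then show ?case by (simp add: lim_imp_Liminf)
    qed
  qed
  also have "\<dots> \<le> liminf (\<lambda>n. \<integral>\<^sup>+x. ennreal (h n x + 1 / dens x) \<partial>\<nu>)"
    by (rule nn_integral_liminf) measurable
  also have "\<dots> \<le> liminf (\<lambda>n. ennreal (D + 1 / real (Suc n) + c))"
  proof (rule Liminf_mono[OF always_eventually], rule allI)
    fix n
    have "(\<integral>\<^sup>+x. ennreal (h n x + 1 / dens x) \<partial>\<nu>) = ennreal (\<integral>x. h n x + 1 / dens x \<partial>\<nu>)"
    proof (rule nn_integral_eq_integral)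
      show "AE x in \<nu>. 0 \<le> h n x + 1 / dens x"
        using dens_pos by eventually_elim (rule h_ge)
    qed (use h_int inv in auto)
    also have "(\<integral>x. h n x + 1 / dens x \<partial>\<nu>) = (\<integral>x. h n x \<partial>\<nu>) + c"
      unfolding c_def by (rule Bochner_Integration.integral_add[OF h_int inv])
    also have "\<dots> \<le> D + 1 / real (Suc n) + c"
      using le[of n] by (simp add: h_def)
    finally show "(\<integral>\<^sup>+x. ennreal (h n x + 1 / dens x) \<partial>\<nu>) \<le> ennreal (D + 1 / real (Suc n) + c)"
      by (simp add: ennreal_leI)
  qed
  also have "\<dots> = ennreal (D + 0 + c)"
  proof (rule lim_imp_Liminf)
    show "(\<lambda>n. ennreal (D + 1 / real (Suc n) + c)) \<longlonglongrightarrow> ennreal (D + 0 + c)"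
      using LIMSEQ_Suc[OF lim_1_over_n] by (intro tendsto_ennrealI tendsto_add tendsto_const) auto
  qed simp
  finally have fatou: "(\<integral>\<^sup>+x. ennreal (ln (dens x) + 1 / dens x) \<partial>\<nu>) \<le> ennreal (D + c)" by simp
  have nonneg: "AE x in \<nu>. 0 \<le> ln (dens x) + 1 / dens x"
    using dens_pos
  proof eventually_elim
    case (elim x)
    show ?case by (rule tendsto_lowerbound[OF tendsto_add[OF lim[OF elim] tendsto_const]]) (auto simp: h_ge elim)
  qed
  have int: "integrable \<nu> (\<lambda>x. ln (dens x) + 1 / dens x)"
    using fatou nonneg by (intro integrableI_nonneg) (auto intro: le_less_trans)
  then have int_ln: "integrable \<nu> (\<lambda>x. ln (dens x))"
    using Bochner_Integration.integrable_diff[OF int inv] by simp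
  have "(\<integral>x. ln (dens x) + 1 / dens x \<partial>\<nu>) \<le> D + c"
    using fatou D c0 by (subst (asm) nn_integral_eq_integral[OF int nonneg]) (simp add: ennreal_le_iff del: ennreal_plus)
  then have "(\<integral>x. ln (dens x) \<partial>\<nu>) \<le> D"
    using int_ln inv by (simp add: c_def)
  then show ?thesis by (simp add: KL_div_eq int_ln)
qed

end

section \<open>Divergence along Markov kernels\<close>

text \<open>The clamped log density \<open>h\<close> of the output pair is a bounded test function.
  Donsker--Varadhan for the input pair, tested with \<kappa> times the average of \<open>h\<close>
  under \<open>K x\<close>, and then \<open>dual\<close> bound \<kappa> times the output integral of
  \<open>h\<close> by the input divergence plus an error vanishing with \<open>n\<close>.
  \<open>KL_div_le\<close> removes the clamp.\<close>

theorem KL_div_bind_le: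
  fixes K :: "'a \<Rightarrow> 'b measure"
  assumes prob: "prob_space \<pi>" "prob_space \<nu>" and sets: "sets \<pi> = sets M" "sets \<nu> = sets M"
    and K: "K \<in> M \<rightarrow>\<^sub>M subprob_algebra B" "\<And>x. x \<in> space M \<Longrightarrow> prob_space (K x)"
    and \<kappa>: "0 < \<kappa>"
    and dual: "\<And>h C. h \<in> borel_measurable B \<Longrightarrow> (\<And>y. \<bar>h y\<bar> \<le> C) \<Longrightarrow>
      ln (\<integral>x. exp (\<kappa> * (\<integral>y. h y \<partial>K x)) \<partial>\<pi>) \<le> \<kappa> * ln (\<integral>x. (\<integral>y. exp (h y) \<partial>K x) \<partial>\<pi>)"
  shows "KL_div (bind \<nu> K) (bind \<pi> K) \<le> KL_div \<nu> \<pi> / ereal \<kappa>"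
proof (cases "KL_div \<nu> \<pi> = \<infinity>")
  case True
  then show ?thesis using \<kappa> by simp
next
  case False
  then have ac: "absolutely_continuous \<pi> \<nu>"
    by (auto simp: KL_div_def split: if_splits)
  interpret X: abs_cont_prob \<pi> \<nu>
    by (rule abs_cont_prob.intro[OF prob ac]) (simp add: sets)
  have K\<pi>: "K \<in> \<pi> \<rightarrow>\<^sub>M subprob_algebra B" and K\<nu>: "K \<in> \<nu> \<rightarrow>\<^sub>M subprob_algebra B"
    using K(1) by (simp_all only: measurable_cong_sets[OF sets(1) refl] measurable_cong_sets[OF sets(2) refl])
  have space: "space \<pi> = space M" "space \<nu> = space M"
    by (fact sets_eq_imp_space_eq[OF sets(1)] sets_eq_imp_space_eq[OF sets(2)])+
  have setsY: "sets (bind \<pi> K) = sets B" "sets (bind \<nu> K) = sets B"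
    using X.\<pi>.not_empty X.\<nu>.not_empty sets_kernel[OF K(1)] by (metis sets_bind space)+
  interpret Y: abs_cont_prob "bind \<pi> K" "bind \<nu> K"
  proof (rule abs_cont_prob.intro)
    show "prob_space (bind \<pi> K)"
      using K(2) space by (intro X.\<pi>.prob_space_bind[OF _ K\<pi>] AE_I2) auto
    show "prob_space (bind \<nu> K)"
      using K(2) space by (intro X.\<nu>.prob_space_bind[OF _ K\<nu>] AE_I2) auto
    show "absolutely_continuous (bind \<pi> K) (bind \<nu> K)"
      unfolding absolutely_continuous_def
    proof
      fix A assume "A \<in> null_sets (bind \<pi> K)"
      then have A: "A \<in> sets B" and 0: "emeasure (bind \<pi> K) A = 0" by (auto simp: setsY)
      have [measurable]: "(\<lambda>x. emeasure (K x) A) \<in> borel_measurable \<pi>" "(\<lambda>x. emeasure (K x) A) \<in> borel_measurable \<nu>"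
        using measurable_emeasure_kernel[OF K\<pi> A] measurable_emeasure_kernel[OF K\<nu> A] by auto
      from 0 have "AE x in \<pi>. emeasure (K x) A = 0"
        by (simp add: emeasure_bind[OF X.\<pi>.not_empty K\<pi> A] nn_integral_0_iff_AE)
      then have "AE x in \<nu>. emeasure (K x) A = 0"
        using absolutely_continuous_AE[OF X.sets_eq ac] by blast
      then have "emeasure (bind \<nu> K) A = 0"
        by (simp add: emeasure_bind[OF X.\<nu>.not_empty K\<nu> A] nn_integral_0_iff_AE)
      with A show "A \<in> null_sets (bind \<nu> K)" by (auto simp: setsY)
    qed
  qed (simp add: setsY)
  from False have int: "integrable \<nu> (\<lambda>x. ln (X.dens x))" by (auto simp: X.KL_div_eq split: if_splits)
  define D where "D = (\<integral>x. ln (X.dens x) \<partial>\<nu>)"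
  have KL: "KL_div \<nu> \<pi> = ereal D" by (simp add: X.KL_div_eq int D_def)
  have "0 \<le> D"
    using X.donsker_varadhan[OF int, of "\<lambda>_. 0" 0] by (simp add: D_def X.\<pi>.prob_space)
  have "(\<integral>y. ln (max (1 / real (Suc n)) (min (real (Suc n)) (Y.dens y))) \<partial>bind \<nu> K) \<le> D / \<kappa> + 1 / real (Suc n)" for n
  proof -
    define h where "h y = ln (max (1 / real (Suc n)) (min (real (Suc n)) (Y.dens y)))" for y
    define C where "C = ln (real (Suc n))"
    have dens [measurable]: "Y.dens \<in> borel_measurable B"
      using Y.dens_measurable by (simp only: measurable_cong_sets[OF setsY(1) refl])
    have h_meas [measurable]: "h \<in> borel_measurable B" unfolding h_def by measurable
    have h_Y [measurable]: "h \<in> borel_measurable (bind \<pi> K)"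
      using h_meas by (simp only: measurable_cong_sets[OF setsY(1) refl])
    have h: "\<bar>h y\<bar> \<le> C" for y
      unfolding h_def C_def by (rule abs_ln_clamp_le)
    have mass: "AE x in \<pi>. emeasure (K x) (space (K x)) \<le> ennreal 1" "AE x in \<nu>. emeasure (K x) (space (K x)) \<le> ennreal 1"
      using K(2) space by (auto intro!: AE_I2 simp: prob_space.emeasure_space_1)
    have Ph_meas: "(\<lambda>x. \<integral>y. h y \<partial>K x) \<in> borel_measurable \<pi>"
      using measurable_compose[OF K\<pi> integral_measurable_subprob_algebra[OF h_meas]] by simp
    have Ph: "\<bar>\<integral>y. h y \<partial>K x\<bar> \<le> C" if "x \<in> space \<pi>" for x
    proof -
      interpret Kx: prob_space "K x" using K(2) that space by simp
      have "h \<in> borel_measurable (K x)"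
        using h_meas by (simp only: measurable_cong_sets[OF sets_kernel[OF K\<pi> that] refl])
      then have "integrable (K x) h" using h by (intro Kx.integrable_const_bound[where B=C]) auto
      then have "- C \<le> (\<integral>y. h y \<partial>K x)" "(\<integral>y. h y \<partial>K x) \<le> C"
        using h by (auto intro!: Kx.integral_ge_const Kx.integral_le_const simp: abs_le_iff minus_le_iff)
      then show ?thesis by simp
    qed
    \<comment> \<open>\<open>exp (h y)\<close> is the clamped density: the upper clamp only
      decreases it and the lower clamp adds at most \<open>1 / Suc n\<close>. This is the source of
      the error term.\<close>
    have Y_le: "(\<integral>y. exp (h y) \<partial>bind \<pi> K) \<le> 1 + 1 / real (Suc n)"
    proof -
      have "(\<integral>y. exp (h y) \<partial>bind \<pi> K) \<le> (\<integral>y. Y.dens y + 1 / real (Suc n) \<partial>bind \<pi> K)"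
      proof (rule integral_mono)
        show "integrable (bind \<pi> K) (\<lambda>y. exp (h y))"
          using h by (intro Y.\<pi>.integrable_const_bound[where B="exp C"]) (auto simp: abs_le_iff)
        fix y
        have "exp (h y) = max (1 / real (Suc n)) (min (real (Suc n)) (Y.dens y))"
          unfolding h_def by (rule exp_ln) (simp add: less_max_iff_disj)
        then show "exp (h y) \<le> Y.dens y + 1 / real (Suc n)"
          using Y.dens_nonneg[of y] by (simp del: of_nat_Suc add: min.coboundedI2)
      qed (simp add: Y.dens_integrable)
      also have "\<dots> = 1 + 1 / real (Suc n)"
        using Y.dens_integrable by (simp add: Y.dens_integral Y.\<pi>.prob_space)
      finally show ?thesis .
    qed
    have "(\<integral>y. exp (h y) \<partial>bind \<pi> K) = (\<integral>x. (\<integral>y. exp (h y) \<partial>K x) \<partial>\<pi>)"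
      using h by (intro integral_bind[where B="exp C" and B'=1, OF _ _ K\<pi> _ mass(1)])
        (auto simp: abs_le_iff intro: X.\<pi>.finite_measure_axioms)
    moreover have "exp (- C) \<le> (\<integral>y. exp (h y) \<partial>bind \<pi> K)"
      using h by (intro Y.\<pi>.integral_ge_const Y.\<pi>.integrable_const_bound[where B="exp C"])
        (auto simp: abs_le_iff minus_le_iff)
    ultimately have E: "0 < (\<integral>x. (\<integral>y. exp (h y) \<partial>K x) \<partial>\<pi>)" "(\<integral>x. (\<integral>y. exp (h y) \<partial>K x) \<partial>\<pi>) \<le> 1 + 1 / real (Suc n)"
      using Y_le exp_gt_zero[of "- C"] by linarith+
    then have E': "ln (\<integral>x. (\<integral>y. exp (h y) \<partial>K x) \<partial>\<pi>) \<le> 1 / real (Suc n)"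
      using ln_le_minus_one[OF E(1)] by linarith
    have "\<kappa> * (\<integral>y. h y \<partial>bind \<nu> K) = (\<integral>x. \<kappa> * (\<integral>y. h y \<partial>K x) \<partial>\<nu>)"
      using h by (subst integral_bind[where B=C and B'=1, OF _ _ K\<nu> _ mass(2)])
        (auto intro: X.\<nu>.finite_measure_axioms)
    also have "\<dots> \<le> D + ln (\<integral>x. exp (\<kappa> * (\<integral>y. h y \<partial>K x)) \<partial>\<pi>)"
      unfolding D_def using Ph_meas Ph \<kappa>
      by (intro X.donsker_varadhan[OF int, where C="\<kappa> * C"]) (auto simp: abs_mult)
    also have "\<dots> \<le> D + \<kappa> * ln (\<integral>x. (\<integral>y. exp (h y) \<partial>K x) \<partial>\<pi>)"
      using dual[OF h_meas h] by simp
    also have "\<dots> \<le> D + \<kappa> * (1 / real (Suc n))"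
      using E' \<kappa> by (intro add_left_mono mult_left_mono) auto
    also have "D + \<kappa> * (1 / real (Suc n)) = \<kappa> * (D / \<kappa> + 1 / real (Suc n))"
      using \<kappa> by (simp add: distrib_left)
    finally have "(\<integral>y. h y \<partial>bind \<nu> K) \<le> D / \<kappa> + 1 / real (Suc n)"
      using \<kappa> by (simp only: mult_le_cancel_left_pos)
    then show ?thesis by (simp add: h_def)
  qed
  then have "KL_div (bind \<nu> K) (bind \<pi> K) \<le> ereal (D / \<kappa>)"
    using \<open>0 \<le> D\<close> \<kappa> by (intro Y.KL_div_le) auto
  then show ?thesis using \<kappa> by (simp add: KL)
qed

text \<open>The case \<kappa> = 1, where the dual inequality is Jensen's inequality for
  \<open>exp\<close> under each \<open>K x\<close>.\<close>

lemma KL_div_data_processing: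
  fixes K :: "'a \<Rightarrow> 'b measure"
  assumes prob: "prob_space \<pi>" "prob_space \<nu>" and sets: "sets \<pi> = sets M" "sets \<nu> = sets M"
    and K: "K \<in> M \<rightarrow>\<^sub>M subprob_algebra B" "\<And>x. x \<in> space M \<Longrightarrow> prob_space (K x)"
  shows "KL_div (bind \<nu> K) (bind \<pi> K) \<le> KL_div \<nu> \<pi>"
proof -
  interpret \<pi>: prob_space \<pi> by fact
  have space: "space \<pi> = space M" by (rule sets_eq_imp_space_eq[OF sets(1)])
  have K\<pi>: "K \<in> \<pi> \<rightarrow>\<^sub>M subprob_algebra B"
    using K(1) by (simp only: measurable_cong_sets[OF sets(1) refl])
  have "KL_div (bind \<nu> K) (bind \<pi> K) \<le> KL_div \<nu> \<pi> / ereal 1"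
  proof (rule KL_div_bind_le[OF prob sets K])
    fix h :: "'b \<Rightarrow> real" and C assume h_meas [measurable]: "h \<in> borel_measurable B" and h: "\<And>y. \<bar>h y\<bar> \<le> C"
    have Kx: "\<bar>\<integral>y. h y \<partial>K x\<bar> \<le> C" "exp (- C) \<le> (\<integral>y. exp (h y) \<partial>K x)" "(\<integral>y. exp (h y) \<partial>K x) \<le> exp C"
      "exp (\<integral>y. h y \<partial>K x) \<le> (\<integral>y. exp (h y) \<partial>K x)" if x: "x \<in> space \<pi>" for x
    proof -
      interpret Kx: prob_space "K x" using K(2) x space by simp
      have [measurable]: "h \<in> borel_measurable (K x)"
        using h_meas by (simp only: measurable_cong_sets[OF sets_kernel[OF K\<pi> x] refl])
      have int: "integrable (K x) h" "integrable (K x) (\<lambda>y. exp (h y))"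
      proof -
        show "integrable (K x) h" using h by (intro Kx.integrable_const_bound[where B=C]) auto
        show "integrable (K x) (\<lambda>y. exp (h y))"
          using h by (intro Kx.integrable_const_bound[where B="exp C"]) (auto simp: abs_le_iff)
      qed
      have "- C \<le> (\<integral>y. h y \<partial>K x)" "(\<integral>y. h y \<partial>K x) \<le> C"
        using h int by (auto intro!: Kx.integral_ge_const Kx.integral_le_const simp: abs_le_iff minus_le_iff)
      then show "\<bar>\<integral>y. h y \<partial>K x\<bar> \<le> C" by simp
      show "exp (- C) \<le> (\<integral>y. exp (h y) \<partial>K x)" "(\<integral>y. exp (h y) \<partial>K x) \<le> exp C"
        using h int by (auto intro!: Kx.integral_ge_const Kx.integral_le_const simp: abs_le_iff minus_le_iff)
      show "exp (\<integral>y. h y \<partial>K x) \<le> (\<integral>y. exp (h y) \<partial>K x)"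
        using jensen_exp_weighted[of "K x" "\<lambda>_. 1" h] int by (simp add: Kx.prob_space)
    qed
    have meas [measurable]: "(\<lambda>x. \<integral>y. h y \<partial>K x) \<in> borel_measurable \<pi>" "(\<lambda>x. \<integral>y. exp (h y) \<partial>K x) \<in> borel_measurable \<pi>"
      using measurable_compose[OF K\<pi> integral_measurable_subprob_algebra[of h B]]
        measurable_compose[OF K\<pi> integral_measurable_subprob_algebra[of "\<lambda>y. exp (h y)" B]] by simp_all
    have int: "integrable \<pi> (\<lambda>x. exp (\<integral>y. h y \<partial>K x))" "integrable \<pi> (\<lambda>x. \<integral>y. exp (h y) \<partial>K x)"
    proof -
      show "integrable \<pi> (\<lambda>x. exp (\<integral>y. h y \<partial>K x))"
        using Kx(1) by (intro \<pi>.integrable_const_bound[where B="exp C"] AE_I2) (auto simp: abs_le_iff)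
      have "\<bar>\<integral>y. exp (h y) \<partial>K x\<bar> \<le> exp C" if "x \<in> space \<pi>" for x
        using Kx(2,3)[OF that] exp_gt_zero[of "- C"] by linarith
      then show "integrable \<pi> (\<lambda>x. \<integral>y. exp (h y) \<partial>K x)"
        by (intro \<pi>.integrable_const_bound[where B="exp C"] AE_I2) auto
    qed
    have "exp (- C) \<le> (\<integral>x. exp (\<integral>y. h y \<partial>K x) \<partial>\<pi>)"
      using Kx(1) by (intro \<pi>.integral_ge_const int AE_I2) (auto simp: abs_le_iff minus_le_iff)
    then have pos: "0 < (\<integral>x. exp (\<integral>y. h y \<partial>K x) \<partial>\<pi>)"
      using exp_gt_zero[of "- C"] by linarith
    have "(\<integral>x. exp (\<integral>y. h y \<partial>K x) \<partial>\<pi>) \<le> (\<integral>x. (\<integral>y. exp (h y) \<partial>K x) \<partial>\<pi>)"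
      using Kx(4) by (intro integral_mono int)
    then show "ln (\<integral>x. exp (1 * (\<integral>y. h y \<partial>K x)) \<partial>\<pi>) \<le> 1 * ln (\<integral>x. (\<integral>y. exp (h y) \<partial>K x) \<partial>\<pi>)"
      using pos by (simp add: ln_mono)
  qed simp_all
  then show ?thesis by (cases "KL_div \<nu> \<pi>") auto
qed

section \<open>The proximal kernel\<close>

text \<open>The conditional density of \<open>y\<close> given \<open>x\<close> before
  normalization.\<close>

definition prox_weight :: "('a::euclidean_space \<Rightarrow> real) \<Rightarrow> real \<Rightarrow> 'a \<Rightarrow> 'a \<Rightarrow> real" where
  "prox_weight g \<eta> x y = exp (- g y - (norm (x - y))\<^sup>2 / (2 * \<eta>))"

text \<open>For \<eta> > 0 this is, up to a constant factor, the convolution of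
  \<open>exp (- g y)\<close> with a centred Gaussian of variance \<eta> in each coordinate.\<close>

definition prox_mass :: "('a::euclidean_space \<Rightarrow> real) \<Rightarrow> real \<Rightarrow> 'a \<Rightarrow> real" where
  "prox_mass g \<eta> x = (\<integral>y. prox_weight g \<eta> x y \<partial>lborel)"

lemma pi_Y_given_X_eq:
  "pi_Y_given_X g \<eta> x = density lborel (\<lambda>y. ennreal (prox_weight g \<eta> x y / prox_mass g \<eta> x))"
  by (simp add: pi_Y_given_X_def prox_weight_def prox_mass_def)

text \<open>Moving the base point from \<open>x\<close> to \<open>z\<close> changes the weight by a
  constant and a tilt that is exponential-linear in \<open>y\<close>. Comparing normalizing
  constants at two points thus becomes a question about the Laplace transform at one point.\<close>

lemma prox_weight_shift:
  "prox_weight g \<eta> z y =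
    exp (((norm x)\<^sup>2 - (norm z)\<^sup>2) / (2 * \<eta>) + ((1 / \<eta>) *\<^sub>R (z - x)) \<bullet> y) * prox_weight g \<eta> x y"
proof -
  have "(norm (z - y))\<^sup>2 = (norm (x - y))\<^sup>2 - ((norm x)\<^sup>2 - (norm z)\<^sup>2) - 2 * ((z - x) \<bullet> y)"
    by (simp add: power2_norm_eq_inner algebra_simps inner_commute)
  then have "(norm (z - y))\<^sup>2 / (2 * \<eta>)
      = (norm (x - y))\<^sup>2 / (2 * \<eta>) - ((norm x)\<^sup>2 - (norm z)\<^sup>2) / (2 * \<eta>) - (1 / \<eta>) * ((z - x) \<bullet> y)"
    by (simp add: diff_divide_distrib)
  then show ?thesis
    by (simp add: prox_weight_def exp_add[symmetric])
qed

locale prox_kernel =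
  fixes g :: "'a::euclidean_space \<Rightarrow> real" and \<eta> \<alpha> :: real
  assumes \<eta>: "0 < \<eta>" and \<alpha>: "0 < \<alpha>" and convex: "strongly_convex \<alpha> g"
begin

abbreviation "W \<equiv> prox_weight g \<eta>"
abbreviation "N \<equiv> prox_mass g \<eta>"
abbreviation "P \<equiv> pi_Y_given_X g \<eta>"

lemma g_measurable [measurable]: "g \<in> borel_measurable borel"
  using convex \<alpha> by (auto intro: strongly_convex_borel_measurable)

lemma W_measurable [measurable (raw)]:
  assumes [measurable]: "a \<in> borel_measurable M" "b \<in> borel_measurable M"
  shows "(\<lambda>z. W (a z) (b z)) \<in> borel_measurable M"
  unfolding prox_weight_def by measurable

lemma N_measurable [measurable]: "N \<in> borel_measurable borel"
  unfolding prox_mass_def by measurable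

lemma W_eq_exp: "W x y = exp (- (g y + (norm (x - y))\<^sup>2 / (2 * \<eta>)))"
  by (simp add: prox_weight_def)

lemma W_pos: "0 < W x y"
  by (simp add: prox_weight_def)

lemma prox_convex: "strongly_convex (\<alpha> + 1 / \<eta>) (\<lambda>y. g y + (norm (x - y))\<^sup>2 / (2 * \<eta>))"
  by (rule strongly_convex_add_square_dist[OF convex])

lemma prox_convex_pos: "0 < \<alpha> + 1 / \<eta>"
  using \<eta> \<alpha> by (simp add: add_pos_pos)

lemma W_integrable: "integrable lborel (W x)"
  unfolding W_eq_exp by (rule integrable_exp_strongly_convex[OF prox_convex prox_convex_pos])

lemma W_linear_integrable: "integrable lborel (\<lambda>y. (u \<bullet> y) * W x y)"
  unfolding W_eq_exp by (rule integrable_linear_exp_strongly_convex[OF prox_convex prox_convex_pos])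

lemma W_bounded_integrable:
  assumes [measurable]: "\<phi> \<in> borel_measurable borel" and "\<And>y. \<bar>\<phi> y\<bar> \<le> C"
  shows "integrable lborel (\<lambda>y. \<phi> y * W x y)"
proof (rule Bochner_Integration.integrable_bound)
  show "integrable lborel (\<lambda>y. C * W x y)" using W_integrable by auto
  show "AE y in lborel. norm (\<phi> y * W x y) \<le> norm (C * W x y)"
    using assms(2) W_pos[of x] by (intro AE_I2) (auto simp: abs_mult intro!: mult_right_mono order_trans[OF assms(2) abs_ge_self])
qed measurable

lemma N_pos: "0 < N x"
  using integral_exp_pos[OF W_integrable[of x, unfolded prox_weight_def]]
  by (simp add: prox_mass_def prox_weight_def)

lemma N_bounded: "N x \<le> (\<integral>y. exp (- g y) \<partial>lborel)"
  unfolding prox_mass_def using \<eta>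
  by (intro integral_mono W_integrable integrable_exp_strongly_convex[OF convex \<alpha>]) (simp add: prox_weight_def)

lemma prob_space_P: "prob_space (P x)"
proof
  have "emeasure (P x) (space (P x)) = (\<integral>\<^sup>+y. ennreal (W x y / N x) \<partial>lborel)"
    unfolding pi_Y_given_X_eq by (subst emeasure_density) auto
  also have "\<dots> = ennreal (\<integral>y. W x y / N x \<partial>lborel)"
    using W_integrable W_pos N_pos by (intro nn_integral_eq_integral) (auto intro!: AE_I2 simp: less_imp_le)
  also have "\<dots> = 1" using N_pos[of x] by (simp add: prox_mass_def[symmetric])
  finally show "emeasure (P x) (space (P x)) = 1" .
qed

lemma sets_P [simp, measurable_cong]: "sets (P x) = sets borel"
  by (simp add: pi_Y_given_X_eq)

lemma P_measurable [measurable]: "P \<in> borel \<rightarrow>\<^sub>M subprob_algebra borel"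
proof (rule measurable_subprob_algebra)
  show "subprob_space (P x)" for x
    using prob_space_P by (rule prob_space_imp_subprob_space)
  fix A :: "'a set" assume [measurable]: "A \<in> sets borel"
  have "emeasure (P x) A = (\<integral>\<^sup>+y. ennreal (W x y / N x) * indicator A y \<partial>lborel)" for x
    unfolding pi_Y_given_X_eq by (subst emeasure_density) auto
  then show "(\<lambda>x. emeasure (P x) A) \<in> borel_measurable borel"
    by simp
qed simp

lemma integral_P:
  fixes \<phi> :: "'a \<Rightarrow> real"
  assumes "\<phi> \<in> borel_measurable borel"
  shows "(\<integral>y. \<phi> y \<partial>P x) = (\<integral>y. \<phi> y * W x y \<partial>lborel) / N x"
proof -
  have "(\<integral>y. \<phi> y \<partial>P x) = (\<integral>y. (W x y / N x) *\<^sub>R \<phi> y \<partial>lborel)"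
    unfolding pi_Y_given_X_eq using assms W_pos N_pos
    by (intro integral_density) (auto intro!: AE_I2 simp: less_imp_le)
  also have "\<dots> = (\<integral>y. \<phi> y * W x y / N x \<partial>lborel)"
    by (simp add: mult.commute)
  finally show ?thesis by simp
qed

text \<open>The pairing of \<open>u\<close> with the barycentre of \<open>P x\<close>, kept scalar
  so that no vector-valued integral arises.\<close>

definition mean :: "'a \<Rightarrow> 'a \<Rightarrow> real" where
  "mean x u = (\<integral>y. (u \<bullet> y) * W x y \<partial>lborel) / N x"

lemma mean_scale: "mean x (c *\<^sub>R u) = c * mean x u"
  unfolding mean_def inner_scaleR_left mult.assoc integral_mult_right_zero by simp

text \<open>After the shift to base point \<open>x\<close>, \<open>N z\<close> is a Laplace
  transform of \<open>W x\<close> at \<open>(z - x) / \<eta>\<close>, and the sub-Gaussian bound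
  applies with modulus \<open>\<alpha> + 1 / \<eta>\<close>. The \<open>mean\<close> term is the
  tangent at \<open>x\<close>, the last term the curvature bound.\<close>

lemma ln_N_le:
  "ln (N z) \<le> ln (N x) + ((norm x)\<^sup>2 - (norm z)\<^sup>2) / (2 * \<eta>) + mean x (z - x) / \<eta>
    + (norm (z - x))\<^sup>2 / (2 * \<eta> * (1 + \<eta> * \<alpha>))"
proof -
  let ?q = "((norm x)\<^sup>2 - (norm z)\<^sup>2) / (2 * \<eta>)" and ?u = "(1 / \<eta>) *\<^sub>R (z - x)"
  have eq: "N z = exp ?q * (\<integral>y. exp (?u \<bullet> y) * W x y \<partial>lborel)"
    unfolding prox_mass_def prox_weight_shift[of g \<eta> z _ x] exp_add mult.assoc integral_mult_right_zero by simp
  then have "0 < (\<integral>y. exp (?u \<bullet> y) * W x y \<partial>lborel)"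
    using N_pos[of z] by (simp add: zero_less_mult_iff)
  then have "ln (N z) = ?q + ln (\<integral>y. exp (?u \<bullet> y) * W x y \<partial>lborel)"
    unfolding eq by (subst ln_mult) auto
  also have "\<dots> \<le> ?q + (ln (N x) + mean x ?u + (norm ?u)\<^sup>2 / (2 * (\<alpha> + 1 / \<eta>)))"
    using log_laplace_strongly_convex[OF prox_convex[of x] prox_convex_pos, of ?u]
    unfolding mean_def prox_mass_def W_eq_exp by simp
  also have "(norm ?u)\<^sup>2 / (2 * (\<alpha> + 1 / \<eta>)) = (norm (z - x))\<^sup>2 / (2 * \<eta> * (1 + \<eta> * \<alpha>))"
  proof -
    have "(norm ?u)\<^sup>2 = (norm (z - x))\<^sup>2 / \<eta>\<^sup>2" by (simp add: power_divide)
    moreover have "\<eta>\<^sup>2 * (2 * (\<alpha> + 1 / \<eta>)) = 2 * \<eta> * (1 + \<eta> * \<alpha>)"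
      using \<eta> by (simp add: field_simps power2_eq_square)
    ultimately show ?thesis by simp
  qed
  finally show ?thesis by (simp add: mean_scale)
qed

text \<open>By the shift, the product on the right is the integral of
  \<open>exp (?\<phi> y) * W x y\<close>, so Jensen's inequality under \<open>P x\<close> handles
  \<open>h\<close> and the change of base point at once. The tangent terms agree with those of
  \<open>ln_N_le\<close>, so that they can cancel.\<close>

lemma ln_tilted_N_ge:
  assumes [measurable]: "h \<in> borel_measurable borel" and h: "\<And>y. \<bar>h y\<bar> \<le> C"
  shows "ln (N x) + (\<integral>y. h y \<partial>P x) + ((norm x)\<^sup>2 - (norm z)\<^sup>2) / (2 * \<eta>) + mean x (z - x) / \<eta>
    \<le> ln (N z * (\<integral>y. exp (h y) \<partial>P z))"
proof -
  let ?q = "((norm x)\<^sup>2 - (norm z)\<^sup>2) / (2 * \<eta>)" and ?u = "(1 / \<eta>) *\<^sub>R (z - x)"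
  let ?\<phi> = "\<lambda>y. h y + (?q + ?u \<bullet> y)"
  have hW: "integrable lborel (\<lambda>y. h y * W x y)" using h by (intro W_bounded_integrable) auto
  have uW: "integrable lborel (\<lambda>y. (?u \<bullet> y) * W x y)" by (rule W_linear_integrable)
  have e: "exp (?\<phi> y) * W x y = exp (h y) * W z y" for y
    unfolding prox_weight_shift[of g \<eta> z y x] by (simp add: exp_add)
  have \<phi>: "?\<phi> y * W x y = h y * W x y + ?q * W x y + (?u \<bullet> y) * W x y" for y
    by (simp only: algebra_simps)
  have "(\<integral>y. W x y \<partial>lborel) * exp ((\<integral>y. ?\<phi> y * W x y \<partial>lborel) / (\<integral>y. W x y \<partial>lborel))
      \<le> (\<integral>y. exp (?\<phi> y) * W x y \<partial>lborel)"
  proof (rule jensen_exp_weighted)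
    show "integrable lborel (\<lambda>y. ?\<phi> y * W x y)"
      unfolding \<phi> by (intro Bochner_Integration.integrable_add hW uW integrable_mult_right W_integrable)
    have "\<bar>exp (h y)\<bar> \<le> exp C" for y using h[of y] by simp
    then show "integrable lborel (\<lambda>y. exp (?\<phi> y) * W x y)"
      unfolding e by (intro W_bounded_integrable) auto
  qed (use W_integrable W_pos[of x] N_pos[of x] in \<open>auto simp: less_imp_le prox_mass_def\<close>)
  also have "(\<integral>y. ?\<phi> y * W x y \<partial>lborel) = (\<integral>y. h y * W x y \<partial>lborel) + ?q * N x + (\<integral>y. (?u \<bullet> y) * W x y \<partial>lborel)"
    unfolding \<phi> prox_mass_def
    by (subst Bochner_Integration.integral_add, intro Bochner_Integration.integrable_add hW integrable_mult_right W_integrable, rule uW,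
        subst Bochner_Integration.integral_add, rule hW, intro integrable_mult_right W_integrable) simp
  also have "\<dots> / (\<integral>y. W x y \<partial>lborel) = (\<integral>y. h y \<partial>P x) + ?q + mean x (z - x) / \<eta>"
    using N_pos[of x] mean_scale[of x "1 / \<eta>" "z - x"]
    by (simp add: prox_mass_def[symmetric] integral_P add_divide_distrib mean_def)
  also have "(\<integral>y. exp (?\<phi> y) * W x y \<partial>lborel) = N z * (\<integral>y. exp (h y) \<partial>P z)"
    unfolding e using N_pos[of z] by (subst integral_P) auto
  finally have le: "N x * exp ((\<integral>y. h y \<partial>P x) + ?q + mean x (z - x) / \<eta>) \<le> N z * (\<integral>y. exp (h y) \<partial>P z)"
    by (simp add: prox_mass_def[symmetric])
  have "ln (N x) + ((\<integral>y. h y \<partial>P x) + ?q + mean x (z - x) / \<eta>)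
      = ln (N x * exp ((\<integral>y. h y \<partial>P x) + ?q + mean x (z - x) / \<eta>))"
    using N_pos[of x] by (simp add: ln_mult)
  also have "\<dots> \<le> ln (N z * (\<integral>y. exp (h y) \<partial>P z))"
    using le N_pos[of x] by (intro ln_mono) auto
  finally show ?thesis by simp
qed

lemma P_bounded_integral:
  fixes \<phi> :: "'a \<Rightarrow> real"
  assumes "\<phi> \<in> borel_measurable borel" "\<And>y. a \<le> \<phi> y" "\<And>y. \<phi> y \<le> b"
  shows "a \<le> (\<integral>y. \<phi> y \<partial>P x)" "(\<integral>y. \<phi> y \<partial>P x) \<le> b"
proof -
  interpret prob_space "P x" by (rule prob_space_P)
  have "\<bar>\<phi> y\<bar> \<le> max \<bar>a\<bar> \<bar>b\<bar>" for y using assms(2,3)[of y] by linarith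
  then have "integrable (P x) \<phi>"
    using assms(1) by (intro integrable_const_bound[where B="max \<bar>a\<bar> \<bar>b\<bar>"]) auto
  then show "a \<le> (\<integral>y. \<phi> y \<partial>P x)" "(\<integral>y. \<phi> y \<partial>P x) \<le> b"
    using assms by (auto intro!: integral_ge_const integral_le_const)
qed

lemma P_integral_measurable [measurable]:
  fixes \<phi> :: "'a \<Rightarrow> real"
  assumes [measurable]: "\<phi> \<in> borel_measurable borel"
  shows "(\<lambda>x. \<integral>y. \<phi> y \<partial>P x) \<in> borel_measurable borel"
  by (subst integral_P) measurable

end

section \<open>The dual inequality for the proximal kernel\<close>

text \<open>In logarithms, the lower bound at \<open>z\<close> and \<open>1 - t\<close> times the
  upper bound for \<open>ln (N y)\<close> are both taken from base point \<open>x\<close>. As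
  \<open>z - x = (1 - t) *\<^sub>R (y - x)\<close>, the \<open>mean\<close> terms cancel, and
  \<open>t * \<kappa> = 1\<close> leaves exactly one copy of the average of \<open>h\<close>. Only
  multiples of the squared distance of \<open>x\<close> and \<open>y\<close> remain, and they
  balance.\<close>

lemma prox_prekopa_leindler_condition:
  assumes "prox_kernel g \<eta> \<alpha>g" and f: "strongly_convex \<alpha>f f" and \<alpha>f: "0 < \<alpha>f"
    and \<kappa>: "\<kappa> = (1 + \<eta> * \<alpha>f) * (1 + \<eta> * \<alpha>g)"
    and h_meas: "h \<in> borel_measurable borel" and h: "\<And>y. \<bar>h y\<bar> \<le> C"
  shows "(exp (- f x) * prox_mass g \<eta> x * exp (\<kappa> * (\<integral>y. h y \<partial>pi_Y_given_X g \<eta> x))) powr (1 / \<kappa>)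
      * (exp (- f y) * prox_mass g \<eta> y) powr (1 - 1 / \<kappa>)
    \<le> exp (- f ((1 / \<kappa>) *\<^sub>R x + (1 - 1 / \<kappa>) *\<^sub>R y)) * prox_mass g \<eta> ((1 / \<kappa>) *\<^sub>R x + (1 - 1 / \<kappa>) *\<^sub>R y)
      * (\<integral>w. exp (h w) \<partial>pi_Y_given_X g \<eta> ((1 / \<kappa>) *\<^sub>R x + (1 - 1 / \<kappa>) *\<^sub>R y))"
proof -
  interpret prox_kernel g \<eta> \<alpha>g by fact
  define t where "t = 1 / \<kappa>"
  define z where "z = t *\<^sub>R x + (1 - t) *\<^sub>R y"
  have "\<kappa> > 1" unfolding \<kappa> using \<eta> \<alpha> \<alpha>f by (intro less_1_mult) auto
  then have t: "0 < t" "t < 1" "t * \<kappa> = 1" by (auto simp: t_def)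
  \<comment> \<open>This identity fixes the value of \<kappa>: it equates the curvature bound of
    \<open>ln_N_le\<close> with the convexity of \<open>f\<close> plus the square, as used in fact
    \<open>5\<close>.\<close>
  have dist: "t * (\<alpha>f + 1 / \<eta>) = 1 / (\<eta> * (1 + \<eta> * \<alpha>g))"
  proof -
    have "\<alpha>f + 1 / \<eta> = (1 + \<eta> * \<alpha>f) / \<eta>" using \<eta> by (simp add: field_simps)
    moreover have "1 + \<eta> * \<alpha>f \<noteq> 0" using \<eta> \<alpha>f by (simp add: add_pos_pos less_imp_neq[symmetric])
    ultimately show ?thesis unfolding t_def \<kappa> by simp
  qed
  have zx: "z - x = (1 - t) *\<^sub>R (y - x)" by (simp add: z_def algebra_simps)
  have norm_z: "t * (norm x)\<^sup>2 + (1 - t) * (norm y)\<^sup>2 - (norm z)\<^sup>2 = t * (1 - t) * (norm (y - x))\<^sup>2"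
    unfolding z_def power2_norm_eq_inner by (simp add: inner_commute inner_add_left inner_add_right inner_diff_left inner_diff_right algebra_simps)
  define E where "E = (\<integral>w. exp (h w) \<partial>P z)"
  have "exp (- C) \<le> exp (h w)" "exp (h w) \<le> exp C" for w using h[of w] by auto
  from P_bounded_integral(1)[where \<phi>="\<lambda>w. exp (h w)" and x=z, OF _ this] have E: "E > 0"
    using h_meas by (auto simp: E_def intro: less_le_trans[OF exp_gt_zero])
  let ?h = "\<integral>w. h w \<partial>P x" and ?d = "(norm (y - x))\<^sup>2"
  have 1: "ln (N x) + ?h + ((norm x)\<^sup>2 - (norm z)\<^sup>2) / (2 * \<eta>) + (1 - t) * (mean x (y - x) / \<eta>) \<le> ln (N z * E)"
    using ln_tilted_N_ge[OF h_meas h, of x z] by (simp add: E_def zx mean_scale)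
  have 2: "(1 - t) * ln (N y) \<le> (1 - t) * (ln (N x) + ((norm x)\<^sup>2 - (norm y)\<^sup>2) / (2 * \<eta>) + mean x (y - x) / \<eta>
      + ?d / (2 * \<eta> * (1 + \<eta> * \<alpha>g)))"
    using ln_N_le[of y x] t by (intro mult_left_mono) auto
  have 3: "f z + \<alpha>f / 2 * (t * (1 - t)) * ?d \<le> t * f x + (1 - t) * f y"
    using strongly_convex_combination[OF f, of t x y] t by (simp add: z_def norm_minus_commute)
  have 4: "((norm x)\<^sup>2 - (norm z)\<^sup>2) / (2 * \<eta>) - (1 - t) * (((norm x)\<^sup>2 - (norm y)\<^sup>2) / (2 * \<eta>))
      = t * (1 - t) * ?d / (2 * \<eta>)"
    unfolding norm_z[symmetric] using \<eta> by (simp add: field_simps)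
  have 5: "(1 - t) * (?d / (2 * \<eta> * (1 + \<eta> * \<alpha>g))) = \<alpha>f / 2 * (t * (1 - t)) * ?d + t * (1 - t) * ?d / (2 * \<eta>)"
  proof -
    have "?d / (2 * \<eta> * (1 + \<eta> * \<alpha>g)) = ?d / 2 * (t * (\<alpha>f + 1 / \<eta>))" unfolding dist by simp
    show ?thesis unfolding \<open>?d / _ = _\<close> using \<eta> by (simp add: field_simps)
  qed
  have "t * (- f x + ln (N x) + \<kappa> * ?h) + (1 - t) * (- f y + ln (N y)) \<le> - f z + ln (N z * E)"
  proof -
    have "t * (- f x + ln (N x) + \<kappa> * ?h) + (1 - t) * (- f y + ln (N y))
      = t * ln (N x) + ?h + (1 - t) * ln (N y) - (t * f x + (1 - t) * f y)"
      using t by (simp add: algebra_simps)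
    moreover have "(1 - t) * (ln (N x) + ((norm x)\<^sup>2 - (norm y)\<^sup>2) / (2 * \<eta>) + mean x (y - x) / \<eta>
      + ?d / (2 * \<eta> * (1 + \<eta> * \<alpha>g))) = ln (N x) - t * ln (N x) + (1 - t) * (((norm x)\<^sup>2 - (norm y)\<^sup>2) / (2 * \<eta>))
       + (1 - t) * (mean x (y - x) / \<eta>) + (1 - t) * (?d / (2 * \<eta> * (1 + \<eta> * \<alpha>g)))"
      by (simp only: algebra_simps)
    ultimately show ?thesis using 1 2 3 4 5 by linarith
  qed
  then have "exp (t * (- f x + ln (N x) + \<kappa> * ?h) + (1 - t) * (- f y + ln (N y))) \<le> exp (- f z + ln (N z * E))"
    by simp
  also have "exp (- f z + ln (N z * E)) = exp (- f z) * N z * E"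
    using N_pos[of z] E by (simp add: exp_diff exp_minus divide_inverse mult_ac)
  also have "exp (t * (- f x + ln (N x) + \<kappa> * ?h) + (1 - t) * (- f y + ln (N y)))
      = (exp (- f x) * N x * exp (\<kappa> * ?h)) powr t * (exp (- f y) * N y) powr (1 - t)"
    using N_pos[of x] N_pos[of y] by (simp add: powr_def exp_add ln_mult)
  finally show ?thesis
    by (simp add: z_def t_def E_def)
qed

text \<open>\<open>N\<close> is bounded by the integral of \<open>exp (- g y)\<close>, so a multiple
  of \<open>exp (- f x)\<close> dominates.\<close>

lemma integrable_marginal_weight:
  assumes "prox_kernel g \<eta> \<alpha>g" and f: "strongly_convex \<alpha>f f" and \<alpha>f: "0 < \<alpha>f"
    and [measurable]: "\<phi> \<in> borel_measurable borel" and \<phi>: "\<And>x. \<bar>\<phi> x\<bar> \<le> C"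
  shows "integrable lborel (\<lambda>x. exp (- f x) * prox_mass g \<eta> x * \<phi> x)"
proof (rule Bochner_Integration.integrable_bound)
  interpret prox_kernel g \<eta> \<alpha>g by fact
  have [measurable]: "f \<in> borel_measurable borel"
    using f \<alpha>f by (auto intro: strongly_convex_borel_measurable)
  show "integrable lborel (\<lambda>x. exp (- f x) * ((\<integral>y. exp (- g y) \<partial>lborel) * C))"
    using integrable_exp_strongly_convex[OF f \<alpha>f] by simp
  have "\<bar>exp (- f x) * N x * \<phi> x\<bar> \<le> exp (- f x) * ((\<integral>y. exp (- g y) \<partial>lborel) * C)" for x
    unfolding mult.assoc abs_mult[of "exp (- f x)"] abs_mult[of "N x"]
    using N_bounded[of x] N_pos[of x] \<phi>[of x] by (auto intro!: mult_mono)
  then show "AE x in lborel. norm (exp (- f x) * N x * \<phi> x) \<le> norm (exp (- f x) * ((\<integral>y. exp (- g y) \<partial>lborel) * C))"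
    by (intro AE_I2) (simp add: order_trans[OF _ abs_ge_self])
  show "(\<lambda>x. exp (- f x) * N x * \<phi> x) \<in> borel_measurable lborel" by measurable
qed

text \<open>Prekopa--Leindler with weight \<open>1 / \<kappa>\<close> and the condition just proved.
  Dividing by the total mass of \<open>m\<close> gives the dual inequality of
  \<open>KL_div_bind_le\<close>, raised to the power \<open>1 / \<kappa>\<close>.\<close>

lemma prox_dual_inequality:
  fixes f g :: "'a::euclidean_space \<Rightarrow> real"
  assumes g: "prox_kernel g \<eta> \<alpha>g" and f: "strongly_convex \<alpha>f f" and \<alpha>f: "0 < \<alpha>f"
    and \<kappa>: "\<kappa> = (1 + \<eta> * \<alpha>f) * (1 + \<eta> * \<alpha>g)"
    and [measurable]: "h \<in> borel_measurable borel" and h: "\<And>y. \<bar>h y\<bar> \<le> C"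
  defines "m \<equiv> \<lambda>x. exp (- f x) * prox_mass g \<eta> x"
  shows "(\<integral>x. m x * exp (\<kappa> * (\<integral>y. h y \<partial>pi_Y_given_X g \<eta> x)) \<partial>lborel) powr (1 / \<kappa>)
      * (\<integral>x. m x \<partial>lborel) powr (1 - 1 / \<kappa>)
    \<le> (\<integral>x. m x * (\<integral>y. exp (h y) \<partial>pi_Y_given_X g \<eta> x) \<partial>lborel)"
proof -
  interpret prox_kernel g \<eta> \<alpha>g by fact
  have \<kappa>1: "\<kappa> > 1" unfolding \<kappa> using \<eta> \<alpha> \<alpha>f by (intro less_1_mult) auto
  have h': "- C \<le> h y" "h y \<le> C" for y using h[of y] by auto
  have eh: "0 \<le> exp (h y)" "exp (h y) \<le> exp C" for y using h[of y] by auto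
  have Ph: "\<bar>\<integral>y. h y \<partial>P x\<bar> \<le> C" for x
    using P_bounded_integral[where \<phi>=h and x=x, OF _ h'] by auto
  have Peh: "0 \<le> (\<integral>y. exp (h y) \<partial>P x)" "(\<integral>y. exp (h y) \<partial>P x) \<le> exp C" for x
    using P_bounded_integral[where \<phi>="\<lambda>w. exp (h w)" and x=x, OF _ eh] by auto
  have "\<kappa> * (\<integral>y. h y \<partial>P x) \<le> \<kappa> * C" for x
    using Ph[of x] \<kappa>1 by (intro mult_left_mono) auto
  then have eK: "\<bar>exp (\<kappa> * (\<integral>y. h y \<partial>P x))\<bar> \<le> exp (\<kappa> * C)" for x by simp
  have m0: "0 \<le> m x" for x using N_pos[of x] by (simp add: m_def)
  show ?thesis
  proof (rule prekopa_leindler)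
    show "integrable lborel (\<lambda>x. m x * exp (\<kappa> * (\<integral>y. h y \<partial>P x)))"
      unfolding m_def using eK by (intro integrable_marginal_weight[OF g f \<alpha>f]) auto
    show "integrable lborel m"
      using integrable_marginal_weight[OF g f \<alpha>f, of "\<lambda>_. 1" 1] by (simp add: m_def)
    show "integrable lborel (\<lambda>x. m x * (\<integral>y. exp (h y) \<partial>P x))"
      unfolding m_def using Peh by (intro integrable_marginal_weight[OF g f \<alpha>f, of _ "exp C"]) auto
    show "(m x * exp (\<kappa> * (\<integral>y. h y \<partial>P x))) powr (1 / \<kappa>) * m y powr (1 - 1 / \<kappa>)
      \<le> m ((1 / \<kappa>) *\<^sub>R x + (1 - 1 / \<kappa>) *\<^sub>R y) * (\<integral>w. exp (h w) \<partial>P ((1 / \<kappa>) *\<^sub>R x + (1 - 1 / \<kappa>) *\<^sub>R y))" for x y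
      unfolding m_def by (rule prox_prekopa_leindler_condition[OF g f \<alpha>f \<kappa> _ h]) simp
  qed (use \<kappa>1 m0 Peh in auto)
qed

section \<open>The Gibbs sampler\<close>

lemma joint_dens_eq: "joint_dens f g \<eta> (x, y) = exp (- f x) * prox_weight g \<eta> x y"
  by (simp add: joint_dens_def prox_weight_def exp_add[symmetric])

lemma joint_dens_swap: "joint_dens g f \<eta> (y, x) = joint_dens f g \<eta> (x, y)"
  by (simp add: joint_dens_def norm_minus_commute)

text \<open>By symmetry of the norm, the second conditional is the same kernel built from
  \<open>f\<close>; results about one half step transfer to the other by exchanging \<open>f\<close>
  and \<open>g\<close>.\<close>

lemma pi_X_given_Y_eq: "pi_X_given_Y f \<eta> = pi_Y_given_X f \<eta>"
  by (simp add: fun_eq_iff pi_X_given_Y_def pi_Y_given_X_def norm_minus_commute)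

section \<open>The target law, its marginals and its disintegration\<close>

locale gibbs_pair = prox_kernel g \<eta> \<alpha>g + f: prox_kernel f \<eta> \<alpha>f
  for f g :: "'a::euclidean_space \<Rightarrow> real" and \<eta> \<alpha>f \<alpha>g
begin

text \<open>The joint density with \<open>y\<close> integrated out, that is, the marginal density of
  \<open>x\<close> before normalization.\<close>

definition m :: "'a \<Rightarrow> real" where
  "m x = exp (- f x) * N x"

definition Z :: real where
  "Z = (\<integral>w. joint_dens f g \<eta> w \<partial>lborel)"

lemma m_measurable [measurable]: "m \<in> borel_measurable borel"
  unfolding m_def by measurable

lemma m_pos: "0 < m x"
  by (simp add: m_def N_pos)

lemma joint_dens_measurable [measurable]: "joint_dens f g \<eta> \<in> borel_measurable borel"
  unfolding joint_dens_def borel_prod[symmetric] by measurable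

lemma joint_dens_Pair_measurable [measurable (raw)]:
  assumes [measurable]: "a \<in> borel_measurable M" "b \<in> borel_measurable M"
  shows "(\<lambda>z. joint_dens f g \<eta> (a z, b z)) \<in> borel_measurable M"
  unfolding joint_dens_def fst_conv snd_conv by measurable

lemma joint_dens_pos: "0 < joint_dens f g \<eta> z"
  by (simp add: joint_dens_def)

lemma m_integrable: "integrable lborel m"
  using integrable_marginal_weight[OF prox_kernel_axioms f.convex f.\<alpha>, of "\<lambda>_. 1" 1] by (simp add: m_def[abs_def])

lemma nn_integral_lborel_pair:
  fixes \<phi> :: "'a \<times> 'a \<Rightarrow> ennreal"
  assumes "\<phi> \<in> borel_measurable borel"
  shows "(\<integral>\<^sup>+z. \<phi> z \<partial>lborel) = (\<integral>\<^sup>+x. \<integral>\<^sup>+y. \<phi> (x, y) \<partial>lborel \<partial>lborel)"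
  unfolding lborel_prod[symmetric]
  using assms by (intro lborel.nn_integral_fst[symmetric]) (simp add: lborel_prod)

lemma nn_integral_W: "(\<integral>\<^sup>+y. ennreal (joint_dens f g \<eta> (x, y)) \<partial>lborel) = ennreal (m x)"
proof -
  have "(\<integral>\<^sup>+y. ennreal (joint_dens f g \<eta> (x, y)) \<partial>lborel) = ennreal (\<integral>y. exp (- f x) * W x y \<partial>lborel)"
    unfolding joint_dens_eq using W_integrable W_pos[of x]
    by (intro nn_integral_eq_integral) (auto simp: less_imp_le)
  then show ?thesis by (simp add: m_def prox_mass_def)
qed

lemma nn_integral_joint: "(\<integral>\<^sup>+z. ennreal (joint_dens f g \<eta> z) \<partial>lborel) = ennreal (\<integral>x. m x \<partial>lborel)"
proof -
  have "(\<integral>\<^sup>+z. ennreal (joint_dens f g \<eta> z) \<partial>lborel) = (\<integral>\<^sup>+x. ennreal (m x) \<partial>lborel)"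
    by (subst nn_integral_lborel_pair) (simp_all add: nn_integral_W)
  then show ?thesis
    using m_integrable m_pos by (simp add: nn_integral_eq_integral less_imp_le)
qed

lemma joint_dens_integrable: "integrable lborel (joint_dens f g \<eta>)"
  by (rule integrableI_nonneg) (auto simp: nn_integral_joint joint_dens_pos less_imp_le)

lemma Z_eq: "Z = (\<integral>x. m x \<partial>lborel)"
proof -
  have "ennreal Z = ennreal (\<integral>x. m x \<partial>lborel)"
    unfolding Z_def nn_integral_joint[symmetric] using joint_dens_integrable
    by (intro nn_integral_eq_integral[symmetric]) (auto simp: joint_dens_pos less_imp_le)
  then show ?thesis
    using m_pos joint_dens_pos by (auto simp: Z_def less_imp_le Bochner_Integration.integral_nonneg)
qed

lemma Z_pos: "0 < Z"
  using integral_exp_pos[of "\<lambda>x. ln (m x)"] m_integrable m_pos by (simp add: Z_eq)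

lemma nn_integral_pi_XY:
  assumes [measurable]: "\<phi> \<in> borel_measurable borel"
  shows "(\<integral>\<^sup>+z. \<phi> z \<partial>pi_XY f g \<eta>)
    = (\<integral>\<^sup>+x. \<integral>\<^sup>+y. ennreal (joint_dens f g \<eta> (x, y) / Z) * \<phi> (x, y) \<partial>lborel \<partial>lborel)"
proof -
  have "(\<integral>\<^sup>+z. \<phi> z \<partial>pi_XY f g \<eta>) = (\<integral>\<^sup>+z. ennreal (joint_dens f g \<eta> z / Z) * \<phi> z \<partial>lborel)"
    unfolding pi_XY_def Z_def[symmetric] by (rule nn_integral_density) auto
  then show ?thesis
    by (subst (asm) nn_integral_lborel_pair) auto
qed

lemma nn_integral_pi_X:
  assumes [measurable]: "\<phi> \<in> borel_measurable borel"
  shows "(\<integral>\<^sup>+x. \<phi> x \<partial>pi_X f g \<eta>)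
    = (\<integral>\<^sup>+x. \<integral>\<^sup>+y. ennreal (joint_dens f g \<eta> (x, y) / Z) * \<phi> x \<partial>lborel \<partial>lborel)"
proof -
  have [measurable]: "(fst :: 'a \<times> 'a \<Rightarrow> 'a) \<in> borel_measurable borel"
    unfolding borel_prod[symmetric] by measurable
  have "(\<integral>\<^sup>+x. \<phi> x \<partial>pi_X f g \<eta>) = (\<integral>\<^sup>+z. \<phi> (fst z) \<partial>pi_XY f g \<eta>)"
    unfolding pi_X_def by (rule nn_integral_distr) (auto simp: pi_XY_def)
  then show ?thesis by (subst (asm) nn_integral_pi_XY) auto
qed

lemma sets_pi_X [simp, measurable_cong]: "sets (pi_X f g \<eta>) = sets borel"
  by (simp add: pi_X_def)

text \<open>Disintegration: the joint density is the marginal density times the conditional density,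
  since \<open>N x\<close> cancels.\<close>

lemma nn_integral_joint_dens_section:
  assumes [measurable]: "\<phi> \<in> borel_measurable borel"
  shows "(\<integral>\<^sup>+y. ennreal (joint_dens f g \<eta> (x, y) / Z) * \<phi> y \<partial>lborel) = ennreal (m x / Z) * (\<integral>\<^sup>+y. \<phi> y \<partial>P x)"
proof -
  have "ennreal (m x / Z) * (\<integral>\<^sup>+y. \<phi> y \<partial>P x) = ennreal (m x / Z) * (\<integral>\<^sup>+y. ennreal (W x y / N x) * \<phi> y \<partial>lborel)"
    unfolding pi_Y_given_X_eq by (subst nn_integral_density) auto
  also have "\<dots> = (\<integral>\<^sup>+y. ennreal (m x / Z) * (ennreal (W x y / N x) * \<phi> y) \<partial>lborel)"
    by (subst nn_integral_cmult) auto
  also have "\<dots> = (\<integral>\<^sup>+y. ennreal (joint_dens f g \<eta> (x, y) / Z) * \<phi> y \<partial>lborel)"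
  proof (intro nn_integral_cong)
    fix y
    have "m x / Z * (W x y / N x) = joint_dens f g \<eta> (x, y) / Z"
      using N_pos[of x] by (simp add: m_def joint_dens_eq)
    then show "ennreal (m x / Z) * (ennreal (W x y / N x) * \<phi> y) = ennreal (joint_dens f g \<eta> (x, y) / Z) * \<phi> y"
      using m_pos[of x] Z_pos W_pos[of x y] N_pos[of x]
      by (simp add: mult.assoc[symmetric] ennreal_mult[symmetric] less_imp_le)
  qed
  finally show ?thesis by simp
qed

lemma pi_X_eq: "pi_X f g \<eta> = density lborel (\<lambda>x. ennreal (m x / Z))"
proof (rule measure_eqI)
  fix A assume "A \<in> sets (pi_X f g \<eta>)"
  then have [measurable]: "A \<in> sets borel" by simp
  have "emeasure (pi_X f g \<eta>) A = (\<integral>\<^sup>+x. indicator A x \<partial>pi_X f g \<eta>)" by simp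
  also have "\<dots> = (\<integral>\<^sup>+x. ennreal (m x / Z) * indicator A x \<partial>lborel)"
    using prob_space.emeasure_space_1[OF prob_space_P]
    by (subst nn_integral_pi_X) (auto simp: nn_integral_joint_dens_section)
  finally show "emeasure (pi_X f g \<eta>) A = emeasure (density lborel (\<lambda>x. ennreal (m x / Z))) A"
    by (simp add: emeasure_density)
qed simp

lemma prob_space_pi_X: "prob_space (pi_X f g \<eta>)"
proof
  have "emeasure (pi_X f g \<eta>) (space (pi_X f g \<eta>)) = (\<integral>\<^sup>+x. ennreal (m x / Z) \<partial>lborel)"
    unfolding pi_X_eq by (subst emeasure_density) auto
  also have "\<dots> = ennreal (\<integral>x. m x / Z \<partial>lborel)"
    using m_integrable m_pos Z_pos by (intro nn_integral_eq_integral) (auto simp: less_imp_le)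
  also have "\<dots> = 1" using Z_pos by (simp add: Z_eq[symmetric])
  finally show "emeasure (pi_X f g \<eta>) (space (pi_X f g \<eta>)) = 1" .
qed

text \<open>Fubini; with the roles exchanged the model is normalized by an integral over swapped
  pairs, which must be matched with \<open>Z\<close>.\<close>

lemma Z_swap: "(\<integral>w. joint_dens g f \<eta> w \<partial>lborel) = Z"
proof -
  interpret s: gibbs_pair g f \<eta> \<alpha>g \<alpha>f by unfold_locales
  have "ennreal s.Z = (\<integral>\<^sup>+z. ennreal (joint_dens g f \<eta> z) \<partial>lborel)"
    by (simp add: s.nn_integral_joint s.Z_eq)
  also have "\<dots> = (\<integral>\<^sup>+y. \<integral>\<^sup>+x. ennreal (joint_dens g f \<eta> (y, x)) \<partial>lborel \<partial>lborel)"
    by (rule nn_integral_lborel_pair) simp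
  also have "\<dots> = (\<integral>\<^sup>+y. \<integral>\<^sup>+x. ennreal (joint_dens f g \<eta> (x, y)) \<partial>lborel \<partial>lborel)"
    by (simp add: joint_dens_swap)
  also have "\<dots> = (\<integral>\<^sup>+x. \<integral>\<^sup>+y. ennreal (joint_dens f g \<eta> (x, y)) \<partial>lborel \<partial>lborel)"
    by (rule lborel_pair.Fubini') measurable
  also have "\<dots> = ennreal Z"
    using nn_integral_lborel_pair[of "\<lambda>z. ennreal (joint_dens f g \<eta> z)"] by (simp add: nn_integral_joint Z_eq)
  finally have "s.Z = Z" using Z_pos s.Z_pos by simp
  then show ?thesis by (simp add: s.Z_def)
qed

text \<open>The law of \<open>y\<close> under the target is the first marginal of the model with
  \<open>f\<close> and \<open>g\<close> exchanged. Disintegration along \<open>x\<close> and a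
  change of the order of integration produce it.\<close>

lemma bind_pi_X_P: "bind (pi_X f g \<eta>) P = pi_X g f \<eta>"
proof (rule measure_eqI)
  interpret s: gibbs_pair g f \<eta> \<alpha>g \<alpha>f by unfold_locales
  interpret prob_space "pi_X f g \<eta>" by (rule prob_space_pi_X)
  have P: "P \<in> pi_X f g \<eta> \<rightarrow>\<^sub>M subprob_algebra borel" by measurable
  show sets: "sets (bind (pi_X f g \<eta>) P) = sets (pi_X g f \<eta>)"
    using sets_bind[OF _ not_empty, of P borel] by simp
  fix A assume "A \<in> sets (bind (pi_X f g \<eta>) P)"
  then have [measurable]: "A \<in> sets borel" using sets by simp
  have "emeasure (bind (pi_X f g \<eta>) P) A = (\<integral>\<^sup>+x. (\<integral>\<^sup>+y. indicator A y \<partial>P x) \<partial>pi_X f g \<eta>)"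
    by (subst emeasure_bind[OF not_empty P]) auto
  also have "\<dots> = (\<integral>\<^sup>+x. ennreal (m x / Z) * (\<integral>\<^sup>+y. indicator A y \<partial>P x) \<partial>lborel)"
    unfolding pi_X_eq by (subst nn_integral_density) auto
  also have "\<dots> = (\<integral>\<^sup>+x. \<integral>\<^sup>+y. ennreal (joint_dens f g \<eta> (x, y) / Z) * indicator A y \<partial>lborel \<partial>lborel)"
    by (subst nn_integral_joint_dens_section) auto
  also have "\<dots> = (\<integral>\<^sup>+y. \<integral>\<^sup>+x. ennreal (joint_dens f g \<eta> (x, y) / Z) * indicator A y \<partial>lborel \<partial>lborel)"
    by (rule lborel_pair.Fubini'[symmetric]) measurable
  also have "\<dots> = (\<integral>\<^sup>+y. \<integral>\<^sup>+x. ennreal (joint_dens g f \<eta> (y, x) / s.Z) * indicator A y \<partial>lborel \<partial>lborel)"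
    by (simp add: joint_dens_swap s.Z_def Z_swap)
  also have "\<dots> = (\<integral>\<^sup>+y. indicator A y \<partial>pi_X g f \<eta>)"
    by (subst s.nn_integral_pi_X) auto
  finally show "emeasure (bind (pi_X f g \<eta>) P) A = emeasure (pi_X g f \<eta>) A" by simp
qed

definition joint_kernel :: "'a \<Rightarrow> ('a \<times> 'a) measure" where
  "joint_kernel x = distr (P x) lborel (Pair x)"

lemma gibbs_joint_of_eq: "gibbs_joint_of g \<eta> \<nu> = bind \<nu> joint_kernel"
  by (simp add: gibbs_joint_of_def joint_kernel_def[abs_def])

lemma Pair_measurable: "Pair x \<in> P x \<rightarrow>\<^sub>M lborel"
proof -
  have "Pair x \<in> borel \<rightarrow>\<^sub>M (borel \<Otimes>\<^sub>M borel :: ('a \<times> 'a) measure)" by measurable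
  then show ?thesis by (simp add: borel_prod cong: measurable_cong_sets)
qed

lemma prob_space_joint_kernel: "prob_space (joint_kernel x)"
  unfolding joint_kernel_def by (rule prob_space.prob_space_distr[OF prob_space_P Pair_measurable])

lemma joint_kernel_measurable [measurable]: "joint_kernel \<in> borel \<rightarrow>\<^sub>M subprob_algebra lborel"
  unfolding joint_kernel_def[abs_def]
proof (rule measurable_distr2[OF _ P_measurable])
  show "(\<lambda>(x, y). (x, y)) \<in> borel \<Otimes>\<^sub>M borel \<rightarrow>\<^sub>M (lborel :: ('a \<times> 'a) measure)"
    by (simp add: borel_prod)
qed

text \<open>The target arises from its marginal through the same kernel that builds the sampler's
  joint law, so data processing can compare the two.\<close>

lemma bind_pi_X_joint_kernel: "bind (pi_X f g \<eta>) joint_kernel = pi_XY f g \<eta>"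
proof (rule measure_eqI)
  interpret prob_space "pi_X f g \<eta>" by (rule prob_space_pi_X)
  have K: "joint_kernel \<in> pi_X f g \<eta> \<rightarrow>\<^sub>M subprob_algebra lborel" by measurable
  show sets: "sets (bind (pi_X f g \<eta>) joint_kernel) = sets (pi_XY f g \<eta>)"
    using sets_bind[OF _ not_empty, of joint_kernel lborel] by (simp add: joint_kernel_def pi_XY_def)
  fix A assume "A \<in> sets (bind (pi_X f g \<eta>) joint_kernel)"
  then have A [measurable]: "A \<in> sets borel" using sets by (simp add: pi_XY_def)
  then have A' [measurable]: "A \<in> sets (borel \<Otimes>\<^sub>M borel)" unfolding borel_prod .
  have "emeasure (bind (pi_X f g \<eta>) joint_kernel) A = (\<integral>\<^sup>+x. emeasure (joint_kernel x) A \<partial>pi_X f g \<eta>)"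
    by (rule emeasure_bind[OF not_empty K]) simp
  also have "\<dots> = (\<integral>\<^sup>+x. (\<integral>\<^sup>+y. indicator A (x, y) \<partial>P x) \<partial>pi_X f g \<eta>)"
  proof (intro nn_integral_cong)
    fix x
    have "emeasure (joint_kernel x) A = (\<integral>\<^sup>+z. indicator A z \<partial>joint_kernel x)"
      by (simp add: joint_kernel_def)
    also have "\<dots> = (\<integral>\<^sup>+y. indicator A (x, y) \<partial>P x)"
      unfolding joint_kernel_def by (rule nn_integral_distr[OF Pair_measurable]) simp
    finally show "emeasure (joint_kernel x) A = (\<integral>\<^sup>+y. indicator A (x, y) \<partial>P x)" .
  qed
  also have "\<dots> = (\<integral>\<^sup>+x. ennreal (m x / Z) * (\<integral>\<^sup>+y. indicator A (x, y) \<partial>P x) \<partial>lborel)"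
  proof -
    have "(\<lambda>x. \<integral>\<^sup>+y. indicator A (x, y) \<partial>P x) \<in> borel_measurable borel"
      by (rule nn_integral_measurable_subprob_algebra2[where N=borel]) measurable
    then show ?thesis unfolding pi_X_eq by (subst nn_integral_density) auto
  qed
  also have "\<dots> = (\<integral>\<^sup>+x. \<integral>\<^sup>+y. ennreal (joint_dens f g \<eta> (x, y) / Z) * indicator A (x, y) \<partial>lborel \<partial>lborel)"
    by (subst nn_integral_joint_dens_section) auto
  also have "\<dots> = (\<integral>\<^sup>+z. indicator A z \<partial>pi_XY f g \<eta>)"
    by (subst nn_integral_pi_XY) auto
  finally show "emeasure (bind (pi_X f g \<eta>) joint_kernel) A = emeasure (pi_XY f g \<eta>) A"
    by (simp add: pi_XY_def)
qed

section \<open>Contraction along the sampler\<close>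

text \<open>\<open>prox_dual_inequality\<close> is rewritten for the normalized marginal and put in
  logarithmic form, which is the hypothesis \<open>dual\<close> of
  \<open>KL_div_bind_le\<close>.\<close>

lemma KL_div_half_step:
  assumes "prob_space \<nu>" "sets \<nu> = sets borel"
  shows "KL_div (bind \<nu> P) (pi_X g f \<eta>) \<le> KL_div \<nu> (pi_X f g \<eta>) / ereal ((1 + \<eta> * \<alpha>f) * (1 + \<eta> * \<alpha>g))"
  unfolding bind_pi_X_P[symmetric]
proof (rule KL_div_bind_le[OF prob_space_pi_X assms(1) sets_pi_X assms(2) P_measurable prob_space_P])
  define \<kappa> where "\<kappa> = (1 + \<eta> * \<alpha>f) * (1 + \<eta> * \<alpha>g)"
  have \<kappa>1: "\<kappa> > 1" unfolding \<kappa>_def using \<eta> \<alpha> f.\<alpha> by (intro less_1_mult) auto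
  then show "0 < (1 + \<eta> * \<alpha>f) * (1 + \<eta> * \<alpha>g)" by (simp add: \<kappa>_def)
  fix h :: "'a \<Rightarrow> real" and C assume h_meas [measurable]: "h \<in> borel_measurable borel" and h: "\<And>y. \<bar>h y\<bar> \<le> C"
  have pi_int: "(\<integral>x. \<phi> x \<partial>pi_X f g \<eta>) = (\<integral>x. m x * \<phi> x \<partial>lborel) / Z"
    if [measurable]: "\<phi> \<in> borel_measurable borel" for \<phi> :: "'a \<Rightarrow> real"
    unfolding pi_X_eq using m_pos Z_pos by (subst integral_density) (auto simp: less_imp_le)
  have pos: "0 < (\<integral>x. exp (\<phi> x) \<partial>pi_X f g \<eta>)" if "\<And>x. \<bar>\<phi> x\<bar> \<le> c" "\<phi> \<in> borel_measurable borel" for \<phi> :: "'a \<Rightarrow> real" and c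
  proof -
    interpret prob_space "pi_X f g \<eta>" by (rule prob_space_pi_X)
    have "exp (- c) \<le> (\<integral>x. exp (\<phi> x) \<partial>pi_X f g \<eta>)"
      using that by (intro integral_ge_const integrable_const_bound[where B="exp c"]) (auto simp: abs_le_iff minus_le_iff)
    then show ?thesis using exp_gt_zero[of "- c"] by linarith
  qed
  have h': "- C \<le> h y" "h y \<le> C" for y using h[of y] by auto
  have Ph: "\<bar>\<kappa> * (\<integral>y. h y \<partial>P x)\<bar> \<le> \<kappa> * C" for x
    using P_bounded_integral[where \<phi>=h and x=x, OF _ h'] \<kappa>1 by (auto simp: abs_mult abs_le_iff)
  define F where "F = (\<integral>x. exp (\<kappa> * (\<integral>y. h y \<partial>P x)) \<partial>pi_X f g \<eta>)"
  define H where "H = (\<integral>x. (\<integral>y. exp (h y) \<partial>P x) \<partial>pi_X f g \<eta>)"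
  have F: "F > 0" unfolding F_def by (rule pos[OF Ph]) simp
  \<comment> \<open>The exponents of \<open>Z\<close> on the left add up to 1, so the normalizing
    constant drops out.\<close>
  have "(Z * F) powr (1 / \<kappa>) * Z powr (1 - 1 / \<kappa>) \<le> Z * H"
    using prox_dual_inequality[OF prox_kernel_axioms f.convex f.\<alpha> \<kappa>_def h_meas h] Z_pos
    by (simp add: F_def H_def pi_int m_def[symmetric] Z_eq[symmetric])
  also have "(Z * F) powr (1 / \<kappa>) * Z powr (1 - 1 / \<kappa>) = Z * F powr (1 / \<kappa>)"
    using Z_pos F by (simp add: powr_mult powr_diff)
  finally have "F powr (1 / \<kappa>) \<le> H" using Z_pos by simp
  then have "ln (F powr (1 / \<kappa>)) \<le> ln H" using F by (intro ln_mono) auto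
  then have "ln F \<le> \<kappa> * ln H" using F \<kappa>1 by (simp add: ln_powr field_simps)
  then show "ln (\<integral>x. exp ((1 + \<eta> * \<alpha>f) * (1 + \<eta> * \<alpha>g) * (\<integral>y. h y \<partial>P x)) \<partial>pi_X f g \<eta>)
      \<le> (1 + \<eta> * \<alpha>f) * (1 + \<eta> * \<alpha>g) * ln (\<integral>x. (\<integral>y. exp (h y) \<partial>P x) \<partial>pi_X f g \<eta>)"
    by (simp add: F_def H_def \<kappa>_def)
qed

lemma bind_P:
  assumes "prob_space \<nu>" "sets \<nu> = sets borel"
  shows "prob_space (bind \<nu> P)" "sets (bind \<nu> P) = sets borel"
proof -
  interpret prob_space \<nu> by fact
  have P: "P \<in> \<nu> \<rightarrow>\<^sub>M subprob_algebra borel"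
    using P_measurable by (simp only: measurable_cong_sets[OF assms(2) refl])
  show "prob_space (bind \<nu> P)" by (rule prob_space_bind[OF _ P]) (simp add: prob_space_P)
  show "sets (bind \<nu> P) = sets borel" using sets_bind[OF _ not_empty, of P borel] by simp
qed

text \<open>The new \<open>x\<close> depends on the pair only through \<open>y\<close>, so
  associativity of \<open>bind\<close> turns a round into two successive half steps.\<close>

lemma gibbs_update_eq:
  assumes "prob_space \<nu>" "sets \<nu> = sets borel"
  shows "bind (gibbs_joint_of g \<eta> \<nu>) (\<lambda>p. pi_X_given_Y f \<eta> (snd p)) = bind (bind \<nu> P) f.P"
proof -
  have \<nu>: "P \<in> \<nu> \<rightarrow>\<^sub>M subprob_algebra borel" "joint_kernel \<in> \<nu> \<rightarrow>\<^sub>M subprob_algebra lborel"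
    using P_measurable joint_kernel_measurable by (simp_all only: measurable_cong_sets[OF assms(2) refl])
  have snd: "(\<lambda>p. f.P (snd p)) \<in> (lborel :: ('a \<times> 'a) measure) \<rightarrow>\<^sub>M subprob_algebra borel"
  proof -
    have "(\<lambda>p. f.P (snd p)) \<in> (borel \<Otimes>\<^sub>M borel :: ('a \<times> 'a) measure) \<rightarrow>\<^sub>M subprob_algebra borel" by measurable
    then show ?thesis by (simp add: borel_prod)
  qed
  have "bind (gibbs_joint_of g \<eta> \<nu>) (\<lambda>p. pi_X_given_Y f \<eta> (snd p))
      = bind \<nu> (\<lambda>x. bind (joint_kernel x) (\<lambda>p. f.P (snd p)))"
    unfolding gibbs_joint_of_eq pi_X_given_Y_eq by (rule bind_assoc[OF \<nu>(2) snd])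
  also have "\<dots> = bind \<nu> (\<lambda>x. bind (P x) f.P)"
    unfolding joint_kernel_def
    by (subst bind_distr[OF Pair_measurable snd]) (simp_all add: prob_space.not_empty[OF prob_space_P])
  also have "\<dots> = bind (bind \<nu> P) f.P"
    by (rule bind_assoc[OF \<nu>(1) f.P_measurable, symmetric])
  finally show ?thesis .
qed

text \<open>A round is a half step followed by one with \<open>f\<close> and \<open>g\<close>
  exchanged. The factor \<kappa> is symmetric in the two potentials, so the divergence is divided by
  \<open>\<kappa>\<^sup>2\<close> each time; the half step needs a Borel probability measure, so
  this is carried through the induction.\<close>

lemma gibbs_X_contraction:
  assumes \<mu>0: "prob_space \<mu>0" "sets \<mu>0 = sets borel"
  shows "prob_space (gibbs_X \<mu>0 f g \<eta> k) \<and> sets (gibbs_X \<mu>0 f g \<eta> k) = sets borel \<and>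
    KL_div (gibbs_X \<mu>0 f g \<eta> k) (pi_X f g \<eta>)
      \<le> KL_div \<mu>0 (pi_X f g \<eta>) / ereal ((1 + \<eta> * \<alpha>f) ^ (2 * k) * (1 + \<eta> * \<alpha>g) ^ (2 * k))"
proof (induction k)
  case 0
  then show ?case using \<mu>0 by (cases "KL_div \<mu>0 (pi_X f g \<eta>)") auto
next
  case (Suc k)
  interpret s: gibbs_pair g f \<eta> \<alpha>g \<alpha>f by unfold_locales
  define \<nu> where "\<nu> = gibbs_X \<mu>0 f g \<eta> k"
  define \<kappa> where "\<kappa> = (1 + \<eta> * \<alpha>f) * (1 + \<eta> * \<alpha>g)"
  have \<kappa>: "\<kappa> > 0" unfolding \<kappa>_def using \<eta> \<alpha> f.\<alpha> by (intro mult_pos_pos) (auto intro: add_pos_pos)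
  have \<nu>: "prob_space \<nu>" "sets \<nu> = sets borel"
    and IH: "KL_div \<nu> (pi_X f g \<eta>) \<le> KL_div \<mu>0 (pi_X f g \<eta>) / ereal (\<kappa> ^ (2 * k))"
    using Suc by (simp_all add: \<nu>_def \<kappa>_def power_mult_distrib)
  have step: "gibbs_X \<mu>0 f g \<eta> (Suc k) = bind (bind \<nu> P) f.P"
    by (simp add: gibbs_update_eq[OF \<nu>] \<nu>_def[symmetric])
  have "KL_div (bind (bind \<nu> P) f.P) (pi_X f g \<eta>) \<le> KL_div (bind \<nu> P) (pi_X g f \<eta>) / ereal \<kappa>"
    using s.KL_div_half_step[OF bind_P[OF \<nu>]] by (simp add: \<kappa>_def mult.commute)
  also have "\<dots> \<le> (KL_div \<nu> (pi_X f g \<eta>) / ereal \<kappa>) / ereal \<kappa>"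
    using KL_div_half_step[OF \<nu>] \<kappa> by (intro ereal_divide_right_mono) (auto simp: \<kappa>_def)
  also have "\<dots> \<le> ((KL_div \<mu>0 (pi_X f g \<eta>) / ereal (\<kappa> ^ (2 * k))) / ereal \<kappa>) / ereal \<kappa>"
    using IH \<kappa> by (intro ereal_divide_right_mono) auto
  also have "\<dots> = KL_div \<mu>0 (pi_X f g \<eta>) / ereal (\<kappa> ^ (2 * Suc k))"
    using \<kappa> by (cases "KL_div \<mu>0 (pi_X f g \<eta>)") (auto simp: field_simps power2_eq_square)
  finally show ?case
    unfolding step using s.bind_P[OF bind_P[OF \<nu>]] by (simp only: \<kappa>_def power_mult_distrib simp_thms)
qed

end

theorem mainTheorem4:
  fixes f g :: "'a::euclidean_space \<Rightarrow> real"
    and \<eta> \<alpha>f \<alpha>g :: real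
    and \<mu>0 :: "'a measure"
    and k :: nat
  assumes "\<eta> > 0" and "\<alpha>f > 0" and "\<alpha>g > 0"
    and "strongly_convex \<alpha>f f" and "strongly_convex \<alpha>g g"
    and "prob_space \<mu>0" and "sets \<mu>0 = sets lborel"
  shows "KL_div (gibbs_XY \<mu>0 f g \<eta> k) (pi_XY f g \<eta>)
           \<le> KL_div \<mu>0 (pi_X f g \<eta>) /
              ereal ((1 + \<eta> * \<alpha>f) ^ (2 * k) * (1 + \<eta> * \<alpha>g) ^ (2 * k))"
proof -
  interpret gibbs_pair f g \<eta> \<alpha>f \<alpha>g
    using assms by unfold_locales
  have \<mu>: "prob_space (gibbs_X \<mu>0 f g \<eta> k)" "sets (gibbs_X \<mu>0 f g \<eta> k) = sets borel"
    and le: "KL_div (gibbs_X \<mu>0 f g \<eta> k) (pi_X f g \<eta>)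
      \<le> KL_div \<mu>0 (pi_X f g \<eta>) / ereal ((1 + \<eta> * \<alpha>f) ^ (2 * k) * (1 + \<eta> * \<alpha>g) ^ (2 * k))"
    using gibbs_X_contraction[of \<mu>0 k] assms(6,7) by simp_all
  have "KL_div (gibbs_XY \<mu>0 f g \<eta> k) (pi_XY f g \<eta>) \<le> KL_div (gibbs_X \<mu>0 f g \<eta> k) (pi_X f g \<eta>)"
    unfolding gibbs_XY_def gibbs_joint_of_eq bind_pi_X_joint_kernel[symmetric]
    by (rule KL_div_data_processing[OF prob_space_pi_X \<mu>(1) sets_pi_X \<mu>(2) joint_kernel_measurable prob_space_joint_kernel])
  then show ?thesis using le by (rule order_trans)
qed

end
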